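(* Let $V\subset\mathbb{R}^N$ be the system rate region, $\tilde V\supseteq V$ an open convex subset of $\mathbb{R}^N$, and $H:\tilde V\to\mathbb{R}$ a concave continuously differentiable function. Suppose that for every subset $\bar{\mathcal N}^f\subseteq\mathcal N^f$ (including the empty set) there exists $v\in V$ such that $v_n>0$ for all $n\in\bar{\mathcal N}^f$ and $v_n<0$ for all $n\in\mathcal N\setminus\bar{\mathcal N}^f$. Let $V^*$ and $Q^*$ be the sets of optimal solutions of the primal problem and of the dual problem defined in the context. Then the following holds. (i) For any EGPD-trajectory $(x,q)$, as $t\to\infty$, $$x(t)\to V^*,\qquad q(t)\to q^*\ \text{ for some } q^*\in Q^*.$$ (ii) Let compact subsets $V^{\Box}\subset\tilde V$ and $Q^{\Box}\subset\mathbb{R}_+^{N_1}\times\mathbb{R}^{N_2}$ be fixed. Then the convergence $$(x(t),q(t))\to V^*\times Q^*,\qquad t\to\infty,$$ is uniform across all EGPD-trajectories with initial states $(x(0),q(0))\in V^{\Box}\times Q^{\Box}$; that is, for every $\varepsilon>0$ there is $T<\infty$ such that for every such trajectory and every $t\ge T$ the Euclidean distance from $(x(t),q(t))$ to $V^*\times Q^*$ is at most $\varepsilon$.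
   Context: Network nodes: $\mathcal N=\{1,\dots,N\}$, $N\ge1$, is partitioned into constrained nodes $\mathcal N^c=\{1,\dots,N_1\}$ and free nodes $\mathcal N^f=\{N_1+1,\dots,N\}$, with $N_2=N-N_1$; either set may be empty. Rate region: there is a finite nonempty set $K$ of controls. Control $k\in K$ removes a nonrandom vector $\mu(k)\in\mathbb{R}_+^N$ of items and adds a bounded random vector $\lambda(k)\in\mathbb{R}_+^N$ of items. Its drift is $\overline b(k)=\mathbb{E}[\lambda(k)]-\mu(k)\in\mathbb{R}^N$. The system rate region is $$V=\Big\{\sum_{k\in K}\phi_k\,\overline b(k):\ \phi_k\ge0,\ \sum_{k\in K}\phi_k=1\Big\}.$$ Primal problem: maximize $H(v)$ over $v\in V$ subject to $v_n\le0$ for all $n\in\mathcal N^c$ and $v_n=0$ for all $n\in\mathcal N^f$. Its set of optimal solutions is $V^*$. Dual problem: minimize $\max_{v\in V}\big(H(v)-y\cdot v\big)$ over $y\in\mathbb{R}^N$ with $y_n\ge0$ for $n\in\mathcal N^c$ and $y_n\in\mathbb{R}$ for $n\in\mathcal N^f$. Its set of optimal solutions is $Q^*\subseteq\mathbb{R}_+^{N_1}\times\mathbb{R}^{N_2}$. Notation: for $\xi\in\mathbb{R}$ and $\gamma\ge0$, $[\xi]^+_\gamma=\xi$ if $\gamma>0$ and $[\xi]^+_\gamma=\max\{\xi,0\}$ if $\gamma=0$. For a function $f:\mathbb{R}_+\to\mathbb{R}^N$ (or $\mathbb{R}^{2N}$) and a set $A$ in the same space, $f(t)\to A$ means $\inf_{a\in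 A}\|f(t)-a\|\to0$ as $t\to\infty$. EGPD-trajectory: a pair $(x,q)$ of absolutely continuous functions $x,q:[0,\infty)\to\mathbb{R}^N$ such that (a) $x(t)\in\tilde V$ for all $t\ge0$, and for almost all $t\ge0$, $x'(t)=v(t)-x(t)$, where $v(t)\in\arg\max_{v\in V}\,[\nabla H(x(t))-q(t)]\cdot v$; (b) with the same $v(t)$: $q_n(t)\ge0$ for all $t\ge0$ and $n\in\mathcal N^c$; $q_n'(t)=[v_n(t)]^+_{q_n(t)}$ for almost all $t\ge0$, for $n\in\mathcal N^c$; and $q_n'(t)=v_n(t)$ for almost all $t\ge0$, for $n\in\mathcal N^f$. *)

theory Defs
  imports "HOL-Probability.Probability"
begin

text \<open>
  The node set is the finite type \<open>'n\<close>; \<open>C\<close> is the set of constrained nodes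
  and its complement \<open>- C\<close> the set of free nodes.
\<close>

definition drift ::
  "'w measure \<Rightarrow> ('k \<Rightarrow> 'w \<Rightarrow> real ^ 'n) \<Rightarrow> ('k \<Rightarrow> real ^ 'n) \<Rightarrow> 'k \<Rightarrow> real ^ 'n" where
  "drift M lam mu k = integral\<^sup>L M (lam k) - mu k"

definition rate_region ::
  "'k set \<Rightarrow> 'w measure \<Rightarrow> ('k \<Rightarrow> 'w \<Rightarrow> real ^ 'n) \<Rightarrow> ('k \<Rightarrow> real ^ 'n) \<Rightarrow> (real ^ 'n) set" where
  "rate_region K M lam mu =
     {\<Sum>k\<in>K. \<phi> k *\<^sub>R drift M lam mu k | \<phi>. (\<forall>k\<in>K. 0 \<le> \<phi> k) \<and> (\<Sum>k\<in>K. \<phi> k) = 1}"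

definition primal_feasible :: "'n set \<Rightarrow> (real ^ 'n) set \<Rightarrow> (real ^ 'n) set" where
  "primal_feasible C V = {v \<in> V. (\<forall>n\<in>C. v $ n \<le> 0) \<and> (\<forall>n\<in>-C. v $ n = 0)}"

definition primal_optimal ::
  "'n set \<Rightarrow> (real ^ 'n) set \<Rightarrow> (real ^ 'n \<Rightarrow> real) \<Rightarrow> (real ^ 'n) set" where
  "primal_optimal C V H = {v. is_arg_max H (\<lambda>w. w \<in> primal_feasible C V) v}"

definition dual_feasible :: "'n set \<Rightarrow> (real ^ 'n) set" where
  "dual_feasible C = {y. \<forall>n\<in>C. 0 \<le> y $ n}"

text \<open>For nonempty compact \<open>V\<close> and continuous \<open>H\<close> the supremum is attained, so it is the maximum.\<close>

definition dual_objective ::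
  "(real ^ 'n) set \<Rightarrow> (real ^ 'n \<Rightarrow> real) \<Rightarrow> real ^ 'n \<Rightarrow> real" where
  "dual_objective V H y = (SUP v\<in>V. H v - y \<bullet> v)"

definition dual_optimal ::
  "'n set \<Rightarrow> (real ^ 'n) set \<Rightarrow> (real ^ 'n \<Rightarrow> real) \<Rightarrow> (real ^ 'n) set" where
  "dual_optimal C V H = {y. is_arg_min (dual_objective V H) (\<lambda>z. z \<in> dual_feasible C) y}"

text \<open>
  \<open>pos_part_at g z\<close> is \<open>[z]\<^sup>+\<close> with subscript \<open>g\<close>; only \<open>g \<ge> 0\<close> is of interest.
\<close>

definition pos_part_at :: "real \<Rightarrow> real \<Rightarrow> real" where
  "pos_part_at g z = (if g > 0 then z else max z 0)"

text \<open>
  Absolute continuity on an interval \<open>S\<close>: a pair \<open>(a, b)\<close> in the finite set \<open>P\<close> stands for the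
  interval with these endpoints, and the intervals must not overlap.
\<close>

definition abs_continuous_on :: "real set \<Rightarrow> (real \<Rightarrow> 'a::real_normed_vector) \<Rightarrow> bool" where
  "abs_continuous_on S f \<longleftrightarrow>
     (\<forall>\<epsilon>>0. \<exists>\<delta>>0. \<forall>P. finite P
        \<and> (\<forall>(a, b)\<in>P. a \<le> b \<and> {a..b} \<subseteq> S)
        \<and> pairwise (\<lambda>(a, b) (c, d). {a<..<b} \<inter> {c<..<d} = {}) P
        \<and> (\<Sum>(a, b)\<in>P. b - a) < \<delta>
        \<longrightarrow> (\<Sum>(a, b)\<in>P. norm (f b - f a)) < \<epsilon>)"

text \<open>
  On the half-line, absolute continuity is required on every compact subinterval.  For the
  trajectories below, whose derivatives are bounded, this agrees with absolute continuity on the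
  whole half-line.  The values of \<open>x\<close> and \<open>q\<close> at negative times are irrelevant.
\<close>

definition egpd_trajectory ::
  "'n set \<Rightarrow> (real ^ 'n) set \<Rightarrow> (real ^ 'n) set \<Rightarrow> (real ^ 'n \<Rightarrow> real ^ 'n)
    \<Rightarrow> (real \<Rightarrow> real ^ 'n) \<Rightarrow> (real \<Rightarrow> real ^ 'n) \<Rightarrow> bool" where
  "egpd_trajectory C V Vt gradH x q \<longleftrightarrow>
     (\<forall>T\<ge>0. abs_continuous_on {0..T} x \<and> abs_continuous_on {0..T} q)
   \<and> (\<forall>t\<ge>0. x t \<in> Vt)
   \<and> (\<forall>t\<ge>0. \<forall>n\<in>C. 0 \<le> q t $ n)
   \<and> (\<exists>v. AE t in lebesgue_on {0..}.
          is_arg_max (\<lambda>w. (gradH (x t) - q t) \<bullet> w) (\<lambda>w. w \<in> V) (v t)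
        \<and> (x has_vector_derivative (v t - x t)) (at t within {0..})
        \<and> (\<forall>n\<in>C. ((\<lambda>s. q s $ n) has_real_derivative pos_part_at (q t $ n) (v t $ n))
                     (at t within {0..}))
        \<and> (\<forall>n\<in>-C. ((\<lambda>s. q s $ n) has_real_derivative v t $ n) (at t within {0..})))"

text \<open>
  The library sets \<open>infdist p {} = 0\<close>, whereas the distance to the empty set should be infinite;
  hence the explicit nonemptiness.
\<close>

definition tends_to_set :: "(real \<Rightarrow> 'a::metric_space) \<Rightarrow> 'a set \<Rightarrow> bool" where
  "tends_to_set f A \<longleftrightarrow> A \<noteq> {} \<and> ((\<lambda>t. infdist (f t) A) \<longlongrightarrow> 0) at_top"

definition within_distance :: "real \<Rightarrow> 'a::metric_space \<Rightarrow> 'a set \<Rightarrow> bool" where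
  "within_distance \<epsilon> p A \<longleftrightarrow> A \<noteq> {} \<and> infdist p A \<le> \<epsilon>"

end

theory Submission
  imports Defs
begin

text \<open>
  For a dual optimal \<open>y\<close> the function
  \<open>H x - y \<bullet> x - \<bar>q - y\<bar>\<^sup>2 / 2\<close> is, up to an exponentially small term, nondecreasing along
  trajectories: since \<open>v\<close> maximizes \<open>(\<nabla>H x - q) \<bullet> w\<close> over \<open>V\<close>, its derivative is at least
  \<open>(\<nabla>H x - q) \<bullet> w - (\<nabla>H x - y) \<bullet> x\<close> for every \<open>w \<in> V\<close>, and \<open>w = v*\<close>, a primal optimum, gives a
  nonnegative value by concavity and the saddle point property.  It is bounded above because \<open>x\<close>
  approaches \<open>V\<close> exponentially fast.  Hence a state near equilibrium stays near equilibrium, with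
  \<open>q\<close> close to \<open>y\<close> forever; then \<open>q\<close> has small increments, which forces \<open>x\<close> to become nearly
  feasible and nearly optimal.

  Boundedness also yields, within a time that is uniform over compact sets of initial states, a
  window of prescribed length on which the derivative bound is small for all \<open>w\<close> at once.  There
  \<open>x\<close> nearly maximizes the Lagrangian, on whose maximizers \<open>\<nabla>H\<close> is constant.  So \<open>v\<close> nearly
  maximizes \<open>(\<nabla>H v* - q s) \<bullet> w\<close> for all times \<open>s\<close> of the window simultaneously, which makes \<open>q\<close>
  nearly constant on the window and nearly dual optimal, and \<open>x\<close> nearly maximizes the Lagrangian
  of a dual optimum close to \<open>q\<close>.
\<close>

text \<open>Primal and dual optima need not be unique, and the dual optimum that \<open>q\<close>
  approaches depends on the trajectory. So two dual optima occur: a fixed \<open>qs\<close>, for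
  which \<open>\<Phi> qs\<close> can rise only by a bounded amount and must nearly stall somewhere,
  and a point \<open>y\<close> found near \<open>q\<close> at such a moment, for which
  \<open>\<Phi> y\<close> then traps the state. A whole window is needed because \<open>v\<close>
  may jump when the linear program it solves has several solutions: smallness at one instant says
  nothing about how \<open>x\<close> relates to the \<open>v\<close> that follow. Over a long window
  \<open>x\<close> forgets its past exponentially and inherits their near optimality. The bound must
  be small for every \<open>w\<close>: the choice \<open>w = vs\<close> alone puts \<open>x\<close>
  near a Lagrangian maximizer, the other choices make \<open>q\<close> nearly dual optimal.
  Tolerances come from compactness, before any trajectory is given; this is what makes the settling
  time uniform.\<close>

section \<open>Absolutely continuous functions and differential inequalities\<close>

text \<open>Telescoping over the cells: those tagged outside \<open>E\<close> lose at most
  \<open>e\<close> per unit of length, and their lengths add up to at most \<open>b - a\<close>; the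
  others are absorbed wholesale into \<open>d\<close>.\<close>

lemma tagged_division_increments_lower:
  fixes f :: "real \<Rightarrow> real"
  assumes p: "p tagged_division_of {a..b}" and "a \<le> b" and "0 \<le> e"
    and good: "\<And>x u v. (x, {u..v}) \<in> p \<Longrightarrow> u \<le> x \<Longrightarrow> x \<le> v \<Longrightarrow> x \<notin> E \<Longrightarrow> - e * (v - u) \<le> f v - f u"
    and bad: "(\<Sum>(x, k)\<in>{xk\<in>p. fst xk \<in> E}. norm (f (Sup k) - f (Inf k))) \<le> d"
  shows "- e * (b - a) - d \<le> f b - f a"
proof -
  have fin: "finite p" using p by blast
  let ?g = "\<lambda>(x, k). f (Sup k) - f (Inf k)"
  have split: "sum h p = sum h {xk\<in>p. fst xk \<in> E} + sum h {xk\<in>p. fst xk \<notin> E}"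
    for h :: "real \<times> real set \<Rightarrow> real"
    using sum.Int_Diff[OF fin, of h "{xk. fst xk \<in> E}"]
    by (simp add: Collect_conj_eq Int_commute Diff_eq Compl_eq)
  have "f b - f a = sum ?g p"
    using additive_tagged_division_1[OF \<open>a \<le> b\<close> p, of f] by simp
  also have "\<dots> = sum ?g {xk\<in>p. fst xk \<in> E} + sum ?g {xk\<in>p. fst xk \<notin> E}"
    by (rule split)
  finally have eq: "f b - f a = sum ?g {xk\<in>p. fst xk \<in> E} + sum ?g {xk\<in>p. fst xk \<notin> E}" .
  have "\<bar>sum ?g {xk\<in>p. fst xk \<in> E}\<bar> \<le> d"
    using order_trans[OF sum_abs[of ?g "{xk\<in>p. fst xk \<in> E}"]] bad
    by (simp add: split_def)
  moreover have "- e * (b - a) \<le> sum ?g {xk\<in>p. fst xk \<notin> E}"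
  proof -
    have len: "(\<Sum>(x, k)\<in>p. Sup k - Inf k) = b - a"
      using additive_tagged_division_1[OF \<open>a \<le> b\<close> p, of "\<lambda>x. x"] by simp
    have cell: "\<exists>u v. k = {u..v} \<and> u \<le> x \<and> x \<le> v" if "(x, k) \<in> p" for x k
      using tagged_division_ofD(2,4)[OF p that] by (auto simp: cbox_interval)
    have nonneg: "0 \<le> Sup k - Inf k" if "(x, k) \<in> p" for x k
      using cell[OF that] by auto
    have "(\<Sum>xk\<in>{xk\<in>p. fst xk \<notin> E}. Sup (snd xk) - Inf (snd xk)) \<le> (\<Sum>(x, k)\<in>p. Sup k - Inf k)"
      unfolding split_def using fin nonneg by (intro sum_mono2) auto
    then have "- e * (b - a) \<le> (\<Sum>xk\<in>{xk\<in>p. fst xk \<notin> E}. - e * (Sup (snd xk) - Inf (snd xk)))"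
      using \<open>0 \<le> e\<close> len by (simp add: sum_distrib_left[symmetric] sum_negf mult_left_mono)
    also have "\<dots> \<le> sum ?g {xk\<in>p. fst xk \<notin> E}"
    proof (rule sum_mono, clarify)
      fix x k assume xk: "(x, k) \<in> p" "fst (x, k) \<notin> E"
      then obtain u v where "k = {u..v}" "u \<le> x" "x \<le> v" using cell by blast
      then show "- e * (Sup (snd (x, k)) - Inf (snd (x, k))) \<le> f (Sup k) - f (Inf k)"
        using good[of x u v] xk by simp
    qed
    finally show ?thesis .
  qed
  ultimately show ?thesis using eq by linarith
qed

text \<open>Passes from tagged cells to the endpoint pairs that \<open>abs_continuous_on\<close>
  sums over. \<open>J\<close> drops the tag and may identify cells, but only degenerate ones, since
  cells do not overlap; this is why \<open>h\<close> has to vanish on the diagonal.\<close>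

lemma tagged_subdivision_as_intervals:
  assumes p: "p tagged_division_of {a..b::real}" and q: "q \<subseteq> p"
  defines "J \<equiv> \<lambda>(x::real, k::real set). (Inf k, Sup k)"
  shows "finite (J ` q)"
    and "\<forall>(u, v)\<in>J ` q. u \<le> v \<and> {u..v} \<subseteq> {a..b}"
    and "pairwise (\<lambda>(a, b) (c, d). {a<..<b} \<inter> {c<..<d} = {}) (J ` q)"
    and "\<And>h :: real \<Rightarrow> real \<Rightarrow> real. (\<And>u. h u u = 0) \<Longrightarrow> (\<Sum>(u, v)\<in>J ` q. h u v) = (\<Sum>(x, k)\<in>q. h (Inf k) (Sup k))"
proof -
  have fin: "finite q" using p q finite_subset by blast
  then show "finite (J ` q)" by simp
  have cell: "\<exists>u v. k = {u..v} \<and> u \<le> x \<and> x \<le> v \<and> {u..v} \<subseteq> {a..b}" if "(x, k) \<in> q" for x k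
  proof -
    have "(x, k) \<in> p" using that q by blast
    then obtain u v where "k = {u..v}" "x \<in> k" "k \<subseteq> {a..b}"
      using tagged_division_ofD(2,3,4)[OF p, of x k] by (auto simp: cbox_interval)
    then show ?thesis by (intro exI[of _ u] exI[of _ v]) auto
  qed
  show "\<forall>(u, v)\<in>J ` q. u \<le> v \<and> {u..v} \<subseteq> {a..b}"
  proof clarify
    fix u v x k assume "(u, v) = J (x, k)" "(x, k) \<in> q"
    then show "u \<le> v \<and> {u..v} \<subseteq> {a..b}"
      using cell[of x k] unfolding J_def by auto
  qed
  have disj: "{Inf k<..<Sup k} \<inter> {Inf k'<..<Sup k'} = {}"
    if xk: "(x, k) \<in> q" "(x', k') \<in> q" "(x, k) \<noteq> (x', k')" for x k x' k'
  proof -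
    obtain u v where k: "k = {u..v}" "u \<le> v" using cell[OF xk(1)] by force
    obtain u' v' where k': "k' = {u'..v'}" "u' \<le> v'" using cell[OF xk(2)] by force
    have "interior k \<inter> interior k' = {}"
      using tagged_division_ofD(5)[OF p] xk q by blast
    then show ?thesis using k k' by (simp add: interior_atLeastAtMost_real)
  qed
  show "pairwise (\<lambda>(a, b) (c, d). {a<..<b} \<inter> {c<..<d} = {}) (J ` q)"
    unfolding pairwise_def
  proof (intro ballI impI)
    fix s t assume "s \<in> J ` q" "t \<in> J ` q" and ne: "s \<noteq> t"
    then obtain x k x' k' where 1: "(x, k) \<in> q" "(x', k') \<in> q" "s = J (x, k)" "t = J (x', k')"
      by (metis imageE surj_pair)
    with ne have "(x, k) \<noteq> (x', k')" by metis
    from disj[OF 1(1,2) this] 1 show "(\<lambda>(a, b) (c, d). {a<..<b} \<inter> {c<..<d} = {}) s t"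
      by (simp add: J_def)
  qed
  fix h :: "real \<Rightarrow> real \<Rightarrow> real" assume h: "\<And>u. h u u = 0"
  have "(\<Sum>(u, v)\<in>J ` q. h u v) = sum ((\<lambda>(u, v). h u v) \<circ> J) q"
  proof (rule sum.reindex_nontrivial[OF fin])
    fix s t assume st: "s \<in> q" "t \<in> q" "s \<noteq> t" "J s = J t"
    obtain x k x' k' where [simp]: "s = (x, k)" "t = (x', k')" by (metis surj_pair)
    have "{Inf k<..<Sup k} = {}" using disj[of x k x' k'] st by (auto simp: J_def)
    moreover have "Inf k \<le> Sup k" using cell[of x k] st by auto
    ultimately have "Inf k = Sup k" by simp
    then show "(case J s of (u, v) \<Rightarrow> h u v) = 0" by (simp add: J_def h)
  qed
  then show "(\<Sum>(u, v)\<in>J ` q. h u v) = (\<Sum>(x, k)\<in>q. h (Inf k) (Sup k))"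
    by (simp add: J_def split_def comp_def)
qed

text \<open>
  A gauge controls the increments of \<open>f\<close> over intervals tagged outside \<open>E\<close>, and confines those
  tagged in \<open>E\<close> to an open set of small measure, where absolute continuity takes over.
\<close>

lemma abs_continuous_nonneg_deriv_imp_le:
  fixes f :: "real \<Rightarrow> real"
  assumes ac: "abs_continuous_on {a..b} f" and ab: "a \<le> b" and E: "negligible E"
    and deriv: "\<And>t. t \<in> {a..b} - E \<Longrightarrow> \<exists>d\<ge>0. (f has_real_derivative d) (at t within {a..b})"
  shows "f a \<le> f b"
proof (rule field_le_epsilon)
  fix e :: real assume "e > 0"
  \<comment> \<open>Half of \<open>e\<close> is spent on the cells tagged outside \<open>E\<close>,
    half on the others; the \<open>+ 1\<close> covers \<open>a = b\<close>.\<close>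
  define e1 where "e1 = e / (2 * (b - a + 1))"
  have e1: "e1 > 0" using \<open>e > 0\<close> ab by (simp add: e1_def)
  have "e / 2 > 0" using \<open>e > 0\<close> by simp
  from ac[unfolded abs_continuous_on_def, THEN spec, THEN mp, OF this]
  obtain \<delta> where "\<delta> > 0" and \<delta>': "\<forall>P. finite P \<and> (\<forall>(u, v)\<in>P. u \<le> v \<and> {u..v} \<subseteq> {a..b}) \<and>
      pairwise (\<lambda>(a, b) (c, d). {a<..<b} \<inter> {c<..<d} = {}) P \<and> (\<Sum>(u, v)\<in>P. v - u) < \<delta> \<longrightarrow>
      (\<Sum>(u, v)\<in>P. norm (f v - f u)) < e / 2"
    by (elim exE conjE) (rule that)
  note \<delta> = \<open>\<delta> > 0\<close> \<delta>'[rule_format, OF conjI[OF _ conjI[OF _ conjI]]]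
  obtain U where U: "open U" "E \<subseteq> U" "U \<in> lmeasurable" "measure lebesgue U < \<delta>"
  proof -
    have "E \<in> sets lebesgue" using E by (simp add: negligible_iff_null_sets null_sets_def)
    then obtain T where T: "open T" "E \<subseteq> T" "T - E \<in> lmeasurable" "emeasure lebesgue (T - E) < ennreal \<delta>"
      using sets_lebesgue_outer_open[of E \<delta>] \<delta>(1) by blast
    have "T = (T - E) \<union> E" using T(2) by auto
    moreover have "E \<in> lmeasurable" using E negligible_imp_measurable by blast
    ultimately have "T \<in> lmeasurable" using T(3) by (metis fmeasurable.Un)
    moreover have "measure lebesgue T \<le> measure lebesgue (T - E) + measure lebesgue E"
      using measure_Un_le[of "T - E" lebesgue E] T(3) \<open>E \<in> sets lebesgue\<close> \<open>T = (T - E) \<union> E\<close> by auto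
    moreover have "measure lebesgue E = 0" using E negligible_imp_measure0 by blast
    moreover have "measure lebesgue (T - E) < \<delta>"
      using T(3,4) \<delta>(1) by (simp add: emeasure_eq_measure2 ennreal_less_iff)
    ultimately show ?thesis using that T by auto
  qed
  have ex: "\<exists>r>0. (t \<in> E \<longrightarrow> ball t r \<subseteq> U) \<and>
      (t \<in> {a..b} - E \<longrightarrow> (\<forall>s\<in>{a..b} \<inter> ball t r. \<exists>d\<ge>0. \<bar>f s - f t - d * (s - t)\<bar> \<le> e1 * \<bar>s - t\<bar>))" for t
  proof (cases "t \<in> {a..b} - E")
    case True
    then obtain d where d: "d \<ge> 0" "(f has_real_derivative d) (at t within {a..b})" using deriv by blast
    then have "(f has_derivative (*) d) (at t within {a..b})" by (simp add: has_field_derivative_def)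
    then obtain r where "r > 0" "\<forall>s\<in>{a..b}. norm (s - t) < r \<longrightarrow> norm (f s - f t - d * (s - t)) \<le> e1 * norm (s - t)"
      using e1 unfolding has_derivative_within_alt by blast
    then show ?thesis using d(1) True
      by (intro exI[of _ r]) (auto simp: dist_real_def abs_minus_commute intro!: exI[of _ d])
  next
    case False
    show ?thesis
    proof (cases "t \<in> E")
      case True then show ?thesis using U(1,2) False open_contains_ball by blast
    next
      case F: False then show ?thesis using False by (intro exI[of _ 1]) auto
    qed
  qed
  define r where "r t = (SOME r. r>0 \<and> (t \<in> E \<longrightarrow> ball t r \<subseteq> U) \<and>
      (t \<in> {a..b} - E \<longrightarrow> (\<forall>s\<in>{a..b} \<inter> ball t r. \<exists>d\<ge>0. \<bar>f s - f t - d * (s - t)\<bar> \<le> e1 * \<bar>s - t\<bar>)))" for t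
  have r: "r t > 0" "t \<in> E \<Longrightarrow> ball t (r t) \<subseteq> U"
    "t \<in> {a..b} - E \<Longrightarrow> s \<in> {a..b} \<inter> ball t (r t) \<Longrightarrow> \<exists>d\<ge>0. \<bar>f s - f t - d * (s - t)\<bar> \<le> e1 * \<bar>s - t\<bar>" for t s
    using someI_ex[OF ex[of t]] unfolding r_def[symmetric] by blast+
  have "gauge (\<lambda>t. ball t (r t))" using r(1) by (simp add: gauge_def)
  then obtain p where p: "p tagged_division_of {a..b}" "(\<lambda>t. ball t (r t)) fine p"
    by (rule fine_division_exists_real)
  have "- e1 * (b - a) - e / 2 \<le> f b - f a"
  proof (rule tagged_division_increments_lower[OF p(1) ab, where E = E])
    show "0 \<le> e1" using e1 by simp
    fix t u v assume tuv: "(t, {u..v}) \<in> p" "u \<le> t" "t \<le> v" "t \<notin> E"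
    have sub: "{u..v} \<subseteq> {a..b}" using tagged_division_ofD(3)[OF p(1) tuv(1)] .
    have "{u..v} \<subseteq> ball t (r t)" using p(2) tuv(1) by (auto simp: fine_def)
    then have "u \<in> {a..b} \<inter> ball t (r t)" "v \<in> {a..b} \<inter> ball t (r t)" "t \<in> {a..b} - E"
      using sub tuv by (auto simp del: mem_ball)
    then obtain d d' where d: "d \<ge> 0" "\<bar>f u - f t - d * (u - t)\<bar> \<le> e1 * \<bar>u - t\<bar>"
      "d' \<ge> 0" "\<bar>f v - f t - d' * (v - t)\<bar> \<le> e1 * \<bar>v - t\<bar>" using r(3) by meson
    \<comment> \<open>The tag splits the cell: slopes being nonnegative, \<open>f\<close> falls by
      at most \<open>e1 * (t - u)\<close> before the tag and by at most \<open>e1 * (v - t)\<close>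
      after it.\<close>
    have "d * (u - t) \<le> 0" "0 \<le> d' * (v - t)"
      using d(1,3) tuv by (auto simp: mult_nonneg_nonpos)
    then have "f u - f t \<le> e1 * (t - u)" "f v - f t \<ge> - e1 * (v - t)"
      using d(2,4) tuv by auto
    then show "- e1 * (v - u) \<le> f v - f u" by (simp add: algebra_simps)
  next
    let ?q = "{xk\<in>p. fst xk \<in> E}"
    have qp: "?q \<subseteq> p" by auto
    note J = tagged_subdivision_as_intervals[OF p(1) qp]
    \<comment> \<open>The cells tagged in \<open>E\<close> do not overlap and lie in
      \<open>U\<close>, so their total length is at most the measure of \<open>U\<close>.\<close>
    have "(\<Sum>(x, k)\<in>?q. Sup k - Inf k) < \<delta>"
    proof -
      have q: "?q tagged_partial_division_of {a..b}"
        using p(1) qp unfolding tagged_division_of_def by (meson tagged_partial_division_subset)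
      have eq: "(\<Sum>(x, k)\<in>?q. Sup k - Inf k) = (\<Sum>(x, k)\<in>?q. measure lebesgue k)"
      proof (intro sum.cong refl, clarify)
        fix x k assume "(x, k) \<in> p"
        then obtain u v where "k = cbox u v" "u \<le> v"
          using tagged_division_ofD(2,4)[OF p(1), of x k] by auto
        then show "Sup k - Inf k = measure lebesgue k" by simp
      qed
      have "(\<Sum>(x, k)\<in>?q. measure lebesgue k) = (\<Sum>k\<in>snd ` ?q. measure lebesgue k)"
        using sum.over_tagged_division_lemma[OF tagged_partial_division_of_Union_self[OF q], of "measure lebesgue"]
        by auto
      also have "\<dots> = measure lebesgue (\<Union>(snd ` ?q))"
        using content_division[OF division_of_tagged_division[OF tagged_partial_division_of_Union_self[OF q]]]
        by auto
      also have "\<dots> \<le> measure lebesgue U"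
      proof (rule measure_mono_fmeasurable)
        show "\<Union>(snd ` ?q) \<subseteq> U"
        proof clarify
          fix y x k assume "y \<in> snd (x, k)" "(x, k) \<in> p" "fst (x, k) \<in> E"
          then show "y \<in> U" using fineD[OF p(2), of x k] r(2)[of x] by auto
        qed
        show "\<Union>(snd ` ?q) \<in> sets lebesgue"
          using p(1) tagged_division_ofD(4)[OF p(1)] by (intro sets.finite_Union) auto
      qed (rule U(3))
      finally show ?thesis using eq U(4) by simp
    qed
    then have "(\<Sum>(x, k)\<in>?q. norm (f (Sup k) - f (Inf k))) < e / 2"
      using \<delta>(2)[OF J(1-3)] J(4)[of "\<lambda>u v. v - u"] J(4)[of "\<lambda>u v. norm (f v - f u)"] by simp
    then show "(\<Sum>(x, k)\<in>?q. norm (f (Sup k) - f (Inf k))) \<le> e / 2" by simp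
  qed
  moreover have "e1 * (b - a) \<le> e / 2"
    using \<open>e > 0\<close> ab by (simp add: e1_def field_simps)
  ultimately show "f a \<le> f b + e" by simp
qed

text \<open>The extra term \<open>t - s\<close> admits functions built from \<open>g\<close> and a
  Lipschitz function, as in \<open>abs_continuous_bounded_deriv_imp_lipschitz\<close>; a constant
  \<open>g\<close> gives Lipschitz functions themselves.\<close>

lemma abs_continuous_on_dominated:
  assumes g: "abs_continuous_on S g" and "S' \<subseteq> S" and c: "0 \<le> c"
    and le: "\<And>s t. s \<in> S' \<Longrightarrow> t \<in> S' \<Longrightarrow> s \<le> t \<Longrightarrow> norm (f t - f s) \<le> c * (norm (g t - g s) + (t - s))"
  shows "abs_continuous_on S' f"
  unfolding abs_continuous_on_def
proof (intro allI impI)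
  fix \<epsilon> :: real assume "\<epsilon> > 0"
  \<comment> \<open>Both the increments of \<open>g\<close> and the total length will be kept below
    \<open>\<epsilon>'\<close>, hence the factor 2.\<close>
  define \<epsilon>' where "\<epsilon>' = \<epsilon> / (2 * (c + 1))"
  have e: "\<epsilon>' > 0" using \<open>\<epsilon> > 0\<close> c by (simp add: \<epsilon>'_def)
  have "2 * (c + 1) * \<epsilon>' = \<epsilon>" using c by (simp add: \<epsilon>'_def)
  then have e2: "c * (\<epsilon>' + \<epsilon>') < \<epsilon>" using e by (simp add: algebra_simps)
  from g[unfolded abs_continuous_on_def, THEN spec, THEN mp, OF e]
  obtain \<delta> where "\<delta> > 0" and \<delta>: "\<forall>P. finite P \<and> (\<forall>(u, v)\<in>P. u \<le> v \<and> {u..v} \<subseteq> S) \<and>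
      pairwise (\<lambda>(a, b) (c, d). {a<..<b} \<inter> {c<..<d} = {}) P \<and> (\<Sum>(u, v)\<in>P. v - u) < \<delta> \<longrightarrow>
      (\<Sum>(u, v)\<in>P. norm (g v - g u)) < \<epsilon>'"
    by (elim exE conjE) (rule that)
  show "\<exists>\<delta>>0. \<forall>P. finite P \<and> (\<forall>(u, v)\<in>P. u \<le> v \<and> {u..v} \<subseteq> S') \<and>
      pairwise (\<lambda>(a, b) (c, d). {a<..<b} \<inter> {c<..<d} = {}) P \<and> (\<Sum>(u, v)\<in>P. v - u) < \<delta> \<longrightarrow>
      (\<Sum>(u, v)\<in>P. norm (f v - f u)) < \<epsilon>"
  proof (intro exI[of _ "min \<delta> \<epsilon>'"] conjI allI impI, goal_cases)
    case 1 show ?case using e \<open>\<delta> > 0\<close> by simp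
  next
    case (2 P)
    then have P: "finite P" "\<And>u v. (u, v) \<in> P \<Longrightarrow> u \<le> v \<and> {u..v} \<subseteq> S'"
      "pairwise (\<lambda>(a, b) (c, d). {a<..<b} \<inter> {c<..<d} = {}) P" "(\<Sum>(u, v)\<in>P. v - u) < min \<delta> \<epsilon>'" by auto
    have "(\<Sum>(u, v)\<in>P. norm (g v - g u)) < \<epsilon>'"
    proof (rule \<delta>[rule_format, OF conjI[OF P(1) conjI[OF _ conjI[OF P(3)]]]])
      show "\<forall>(u, v)\<in>P. u \<le> v \<and> {u..v} \<subseteq> S" using P(2) \<open>S' \<subseteq> S\<close> by fast
    qed (use P(4) in simp)
    have "(\<Sum>(u, v)\<in>P. norm (f v - f u)) \<le> (\<Sum>(u, v)\<in>P. c * (norm (g v - g u) + (v - u)))"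
    proof (intro sum_mono, clarify)
      fix u v assume "(u, v) \<in> P"
      then have "u \<le> v" "u \<in> S'" "v \<in> S'" using P(2)[of u v] by auto
      then show "norm (f v - f u) \<le> c * (norm (g v - g u) + (v - u))" using le by blast
    qed
    also have "\<dots> = c * ((\<Sum>(u, v)\<in>P. norm (g v - g u)) + (\<Sum>(u, v)\<in>P. v - u))"
      by (simp only: split_def sum.distrib[symmetric] sum_distrib_left)
    also have "\<dots> \<le> c * (\<epsilon>' + \<epsilon>')"
      using \<open>(\<Sum>(u, v)\<in>P. norm (g v - g u)) < \<epsilon>'\<close> P(4) c by (intro mult_left_mono) auto
    finally show ?case using e2 by simp
  qed
qed

lemma abs_continuous_on_subset:
  assumes "abs_continuous_on S f" and "S' \<subseteq> S"
  shows "abs_continuous_on S' f"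
  using assms by (rule abs_continuous_on_dominated[where c = 1]) auto

lemma lipschitz_on_imp_abs_continuous_on:
  fixes f :: "real \<Rightarrow> 'a::real_normed_vector"
  assumes "L-lipschitz_on S f"
  shows "abs_continuous_on S f"
proof (rule abs_continuous_on_dominated[where g = "\<lambda>_. 0::real" and S = S and c = L])
  show "abs_continuous_on S (\<lambda>_. 0::real)"
    unfolding abs_continuous_on_def by (auto intro: exI[of _ 1] simp: split_def)
  show "0 \<le> L" using assms by (rule lipschitz_on_nonneg)
  fix s t assume "s \<in> S" "t \<in> S" "s \<le> t"
  then show "norm (f t - f s) \<le> L * (norm (0 - 0 :: real) + (t - s))"
    using lipschitz_onD[OF assms, of t s] by (simp add: dist_norm)
qed auto

lemma abs_continuous_on_imp_continuous_on:
  fixes f :: "real \<Rightarrow> 'a::real_normed_vector"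
  assumes "abs_continuous_on {a..b} f"
  shows "continuous_on {a..b} f"
  unfolding continuous_on_iff
proof (intro ballI allI impI)
  fix t and e :: real assume t: "t \<in> {a..b}" and "e > 0"
  from assms[unfolded abs_continuous_on_def, THEN spec, THEN mp, OF \<open>e > 0\<close>]
  obtain \<delta> where "\<delta> > 0" and \<delta>: "\<forall>P. finite P \<and> (\<forall>(u, v)\<in>P. u \<le> v \<and> {u..v} \<subseteq> {a..b}) \<and>
      pairwise (\<lambda>(a, b) (c, d). {a<..<b} \<inter> {c<..<d} = {}) P \<and> (\<Sum>(u, v)\<in>P. v - u) < \<delta> \<longrightarrow>
      (\<Sum>(u, v)\<in>P. norm (f v - f u)) < e"
    by (elim exE conjE) (rule that)
  have *: "norm (f v - f u) < e" if "u \<in> {a..b}" "v \<in> {a..b}" "u \<le> v" "v - u < \<delta>" for u v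
    using \<delta>[THEN spec, of "{(u, v)}"] that by auto
  show "\<exists>d>0. \<forall>s\<in>{a..b}. dist s t < d \<longrightarrow> dist (f s) (f t) < e"
  proof (intro exI[of _ \<delta>] conjI ballI impI)
    fix s assume s: "s \<in> {a..b}" "dist s t < \<delta>"
    show "dist (f s) (f t) < e"
      using *[of s t] *[of t s] s t by (cases "s \<le> t") (auto simp: dist_norm norm_minus_commute)
  qed (rule \<open>\<delta> > 0\<close>)
qed

lemma has_real_derivative_inner_left:
  assumes "(f has_vector_derivative d) (at t within S)"
  shows "((\<lambda>s. f s \<bullet> u) has_real_derivative d \<bullet> u) (at t within S)"
  using bounded_linear.has_vector_derivative[OF bounded_linear_inner_left assms]
  by (simp add: has_real_derivative_iff_has_vector_derivative)

text \<open>Reduction to the scalar case by projecting on \<open>u = f t - f s\<close>: the function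
  \<open>B * norm u * r - f r \<bullet> u\<close> of \<open>r\<close> has nonnegative derivative off
  \<open>E\<close>, which bounds \<open>norm u * norm u\<close> by
  \<open>B * (t - s) * norm u\<close>.\<close>

lemma abs_continuous_bounded_deriv_imp_lipschitz:
  fixes f :: "real \<Rightarrow> 'a::real_inner"
  assumes ac: "abs_continuous_on {a..b} f" and E: "negligible E" and "0 \<le> B"
    and deriv: "\<And>t. t \<in> {a..b} - E \<Longrightarrow> \<exists>d. (f has_vector_derivative d) (at t within {a..b}) \<and> norm d \<le> B"
  shows "B-lipschitz_on {a..b} f"
proof -
  have *: "norm (f t - f s) \<le> B * (t - s)" if st: "s \<in> {a..b}" "t \<in> {a..b}" "s \<le> t" for s t
  proof -
    define u where "u = f t - f s"
    define g where "g r = B * norm u * r - f r \<bullet> u" for r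
    have "g s \<le> g t"
    proof (rule abs_continuous_nonneg_deriv_imp_le[OF _ \<open>s \<le> t\<close> E])
      show "abs_continuous_on {s..t} g"
      proof (rule abs_continuous_on_dominated[OF ac])
        show "{s..t} \<subseteq> {a..b}" using st by auto
        show "0 \<le> (B + 1) * norm u" using \<open>0 \<le> B\<close> by simp
        fix p r :: real assume "p \<le> r"
        have "norm (g r - g p) = \<bar>B * norm u * (r - p) - (f r - f p) \<bullet> u\<bar>"
          by (simp add: g_def algebra_simps)
        also have "\<dots> \<le> B * norm u * (r - p) + norm (f r - f p) * norm u"
          using Cauchy_Schwarz_ineq2[of "f r - f p" u] \<open>p \<le> r\<close> \<open>0 \<le> B\<close>
          by (intro order_trans[OF abs_triangle_ineq4]) (auto simp: abs_mult)
        also have "\<dots> \<le> B * norm u * (r - p) + norm (f r - f p) * norm u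
            + (B * norm u * norm (f r - f p) + norm u * (r - p))"
          using \<open>0 \<le> B\<close> \<open>p \<le> r\<close> by simp
        also have "\<dots> = (B + 1) * norm u * (norm (f r - f p) + (r - p))"
          by (simp add: algebra_simps)
        finally show "norm (g r - g p) \<le> (B + 1) * norm u * (norm (f r - f p) + (r - p))" .
      qed
      fix r assume "r \<in> {s..t} - E"
      then have "r \<in> {a..b} - E" using st by auto
      then obtain d where d: "(f has_vector_derivative d) (at r within {a..b})" "norm d \<le> B"
        using deriv by blast
      have "(f has_vector_derivative d) (at r within {s..t})"
        using d(1) by (rule has_vector_derivative_within_subset) (use st in auto)
      then have "(g has_real_derivative B * norm u - d \<bullet> u) (at r within {s..t})"
        unfolding g_def
        by (auto intro!: derivative_eq_intros has_real_derivative_inner_left)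
      moreover have "d \<bullet> u \<le> B * norm u"
        using norm_cauchy_schwarz[of d u] mult_right_mono[OF d(2) norm_ge_zero[of u]] by simp
      ultimately show "\<exists>d\<ge>0. (g has_real_derivative d) (at r within {s..t})"
        by (intro exI[of _ "B * norm u - d \<bullet> u"]) auto
    qed
    then have "(f t - f s) \<bullet> u \<le> B * norm u * (t - s)"
      by (simp add: g_def inner_diff_left right_diff_distrib)
    then have "norm u * norm u \<le> (B * (t - s)) * norm u"
      unfolding u_def[symmetric] by (simp add: dot_square_norm power2_eq_square mult_ac)
    then show ?thesis
      using \<open>0 \<le> B\<close> \<open>s \<le> t\<close> by (cases "u = 0") (auto simp: u_def)
  qed
  show ?thesis
  proof (rule lipschitz_onI[OF _ \<open>0 \<le> B\<close>])
    fix s t assume "s \<in> {a..b}" "t \<in> {a..b}"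
    then show "dist (f s) (f t) \<le> B * dist s t"
      using *[of s t] *[of t s] by (cases "s \<le> t") (auto simp: dist_norm norm_minus_commute)
  qed
qed

lemma lipschitz_deriv_ge_imp_increment_ge:
  fixes f :: "real \<Rightarrow> real"
  assumes L: "L-lipschitz_on {a..b} f" and "a \<le> b" and E: "negligible E"
    and deriv: "\<And>t. t \<in> {a..b} - E \<Longrightarrow> \<exists>d\<ge>k. (f has_real_derivative d) (at t within {a..b})"
  shows "k * (b - a) \<le> f b - f a"
proof -
  have "f a - k * a \<le> f b - k * b"
  proof (rule abs_continuous_nonneg_deriv_imp_le[OF _ \<open>a \<le> b\<close> E])
    have "(L + \<bar>k\<bar>)-lipschitz_on {a..b} (\<lambda>t. f t - k * t)"
      by (intro lipschitz_on_diff L lipschitz_onI) (auto simp: dist_real_def abs_mult right_diff_distrib[symmetric])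
    then show "abs_continuous_on {a..b} (\<lambda>t. f t - k * t)" by (rule lipschitz_on_imp_abs_continuous_on)
    fix t assume "t \<in> {a..b} - E"
    then obtain d where "d \<ge> k" "(f has_real_derivative d) (at t within {a..b})" using deriv by blast
    then show "\<exists>d\<ge>0. ((\<lambda>t. f t - k * t) has_real_derivative d) (at t within {a..b})"
      by (intro exI[of _ "d - k"]) (auto intro!: derivative_eq_intros)
  qed
  then show ?thesis by (simp add: algebra_simps)
qed

text \<open>An integrating factor: \<open>exp t * (f t - k)\<close> has nonnegative derivative off
  \<open>E\<close>. Every later use of the relaxation \<open>x' = v - x\<close> over a stretch of
  time goes through this inequality.\<close>

lemma exp_comparison:
  fixes f :: "real \<Rightarrow> real"
  assumes L: "L-lipschitz_on {a..b} f" and "a \<le> b" and E: "negligible E"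
    and deriv: "\<And>t. t \<in> {a..b} - E \<Longrightarrow> \<exists>d\<ge>k - f t. (f has_real_derivative d) (at t within {a..b})"
  shows "exp (a - b) * (f a - k) \<le> f b - k"
proof -
  define g where "g t = exp t * (f t - k)" for t
  have "bounded (f ` {a..b})"
    using lipschitz_on_continuous_on[OF L] by (intro compact_imp_bounded compact_continuous_image) auto
  then obtain M where "\<forall>t\<in>{a..b}. \<bar>f t\<bar> \<le> M" unfolding bounded_iff by auto
  then have M: "\<bar>f t\<bar> \<le> M" if "t \<in> {a..b}" for t using that by blast
  have "M \<ge> 0" using M[of a] \<open>a \<le> b\<close> by auto
  have L0: "L \<ge> 0" using L by (rule lipschitz_on_nonneg)
  have exp_lip: "\<bar>exp t - exp s\<bar> \<le> exp b * (t - s)" if "s \<le> t" "t \<le> b" for s t :: real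
  proof -
    have "exp t * (1 + (s - t)) \<le> exp t * exp (s - t)" by (intro mult_left_mono exp_ge_add_one_self) auto
    also have "\<dots> = exp s" by (simp add: mult_exp_exp)
    finally have "exp t - exp s \<le> exp t * (t - s)" by (simp add: algebra_simps)
    also have "\<dots> \<le> exp b * (t - s)" using that by (intro mult_right_mono) auto
    finally show ?thesis using that by simp
  qed
  have lip: "\<bar>g t - g s\<bar> \<le> exp b * (L + M + \<bar>k\<bar>) * (t - s)" if "s \<in> {a..b}" "t \<in> {a..b}" "s \<le> t" for s t
  proof -
    have "\<bar>g t - g s\<bar> = \<bar>exp t * (f t - f s) + (exp t - exp s) * (f s - k)\<bar>"
      by (simp add: g_def algebra_simps)
    also have "\<dots> \<le> exp t * \<bar>f t - f s\<bar> + \<bar>exp t - exp s\<bar> * \<bar>f s - k\<bar>"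
      by (rule order_trans[OF abs_triangle_ineq]) (simp add: abs_mult)
    also have "\<dots> \<le> exp b * (L * (t - s)) + (exp b * (t - s)) * (M + \<bar>k\<bar>)"
      using lipschitz_onD[OF L that(2,1)] M[OF that(1)] exp_lip[of s t] that L0
      by (intro add_mono mult_mono) (auto simp: dist_real_def)
    finally show ?thesis by (simp add: algebra_simps)
  qed
  have "g a \<le> g b"
  proof (rule abs_continuous_nonneg_deriv_imp_le[OF _ \<open>a \<le> b\<close> E])
    have "(exp b * (L + M + \<bar>k\<bar>))-lipschitz_on {a..b} g"
    proof (rule lipschitz_onI)
      fix s t assume "s \<in> {a..b}" "t \<in> {a..b}"
      then show "dist (g s) (g t) \<le> exp b * (L + M + \<bar>k\<bar>) * dist s t"
        using lip[of s t] lip[of t s] by (cases "s \<le> t") (auto simp: dist_real_def abs_minus_commute)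
    qed (use \<open>M \<ge> 0\<close> L0 in auto)
    then show "abs_continuous_on {a..b} g" by (rule lipschitz_on_imp_abs_continuous_on)
    fix t assume "t \<in> {a..b} - E"
    then obtain d where d: "d \<ge> k - f t" "(f has_real_derivative d) (at t within {a..b})" using deriv by blast
    show "\<exists>d\<ge>0. (g has_real_derivative d) (at t within {a..b})"
    proof (intro exI conjI)
      show "(g has_real_derivative exp t * (f t - k + d)) (at t within {a..b})"
        unfolding g_def using d(2) by (auto intro!: derivative_eq_intros simp: algebra_simps)
    qed (use d(1) in simp)
  qed
  then have "exp a * (f a - k) \<le> exp b * (f b - k)" by (simp add: g_def)
  then show ?thesis by (simp add: exp_diff field_simps)
qed

lemma AE_lebesgue_on_imp_negligible:
  assumes "AE t in lebesgue_on S. P t" and "S \<in> sets lebesgue"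
  obtains E where "negligible E" and "\<And>t. t \<in> S - E \<Longrightarrow> P t"
proof -
  have "AE t in lebesgue. t \<in> S \<longrightarrow> P t"
    using assms by (simp add: AE_restrict_space_iff)
  then obtain E where "E \<in> null_sets lebesgue" "{t \<in> space lebesgue. \<not> (t \<in> S \<longrightarrow> P t)} \<subseteq> E"
    unfolding eventually_ae_filter by blast
  then show ?thesis using that[of E] by (auto simp: negligible_iff_null_sets)
qed

section \<open>Saddle points\<close>

text \<open>On the compact set where \<open>f \<ge> \<epsilon>\<close>, \<open>g\<close> attains its
  minimum, which is positive by hypothesis. This turns exact characterizations of optimality into
  tolerances that involve no trajectory.\<close>

lemma compact_sublevel_small:
  fixes f g :: "'a::metric_space \<Rightarrow> real"
  assumes "compact S" "continuous_on S f" "continuous_on S g"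
    and "\<And>x. x \<in> S \<Longrightarrow> g x \<le> 0 \<Longrightarrow> f x \<le> 0" and "\<epsilon> > 0"
  shows "\<exists>\<delta>>0. \<forall>x\<in>S. g x < \<delta> \<longrightarrow> f x < \<epsilon>"
proof -
  define A where "A = {x \<in> S. \<epsilon> \<le> f x}"
  have "closed (S \<inter> f -` {\<epsilon>..})"
    using assms(1,2) by (intro continuous_closed_preimage compact_imp_closed closed_atLeast)
  moreover have "A = S \<inter> (S \<inter> f -` {\<epsilon>..})" by (auto simp: A_def)
  ultimately have A: "compact A" using assms(1) by (metis compact_Int_closed)
  show ?thesis
  proof (cases "A = {}")
    case True
    then show ?thesis unfolding A_def by (intro exI[of _ 1]) force
  next
    case False
    have "continuous_on A g" using assms(3) by (rule continuous_on_subset) (auto simp: A_def)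
    then obtain a where a: "a \<in> A" "\<And>x. x \<in> A \<Longrightarrow> g a \<le> g x"
      using continuous_attains_inf[OF A False] by blast
    have "g a > 0" using a(1) assms(4)[of a] \<open>\<epsilon> > 0\<close> by (auto simp: A_def not_le[symmetric])
    then show ?thesis using a(2) by (intro exI[of _ "g a"]) (force simp: A_def)
  qed
qed

lemma inner_vec_le_0:
  fixes y v :: "real ^ 'n"
  assumes "\<And>n. n \<in> C \<Longrightarrow> 0 \<le> y $ n" "\<And>n. n \<in> C \<Longrightarrow> v $ n \<le> 0" "\<And>n. n \<notin> C \<Longrightarrow> v $ n = 0"
  shows "y \<bullet> v \<le> 0"
  unfolding inner_vec_def
proof (rule sum_nonpos)
  fix n show "y $ n \<bullet> v $ n \<le> 0"
    using assms[of n] by (cases "n \<in> C") (auto simp: mult_nonneg_nonpos)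
qed

locale egpd_problem =
  fixes C :: "'n::finite set"
    and V Vt :: "(real ^ 'n) set"
    and H :: "real ^ 'n \<Rightarrow> real"
    and gradH :: "real ^ 'n \<Rightarrow> real ^ 'n"
  assumes compact_V: "compact V" and convex_V: "convex V"
    and V_subset: "V \<subseteq> Vt" and open_Vt: "open Vt" and convex_Vt: "convex Vt"
    and concave_H: "concave_on Vt H"
    and GDERIV_H: "\<And>z. z \<in> Vt \<Longrightarrow> GDERIV H z :> gradH z"
    and cont_gradH: "continuous_on Vt gradH"
    and sign_patterns: "\<And>F. F \<subseteq> - C \<Longrightarrow> \<exists>v\<in>V. (\<forall>n\<in>F. v $ n > 0) \<and> (\<forall>n\<in>-F. v $ n < 0)"
begin

lemma V_nonempty: "V \<noteq> {}"
  using sign_patterns[of "{}"] by auto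

lemma closed_V: "closed V"
  using compact_V by (rule compact_imp_closed)

lemma has_derivative_H: "z \<in> Vt \<Longrightarrow> (H has_derivative (\<lambda>h. h \<bullet> gradH z)) (at z)"
  using GDERIV_H[of z] by (simp add: gderiv_def)

lemma continuous_on_H: "continuous_on Vt H"
  using has_derivative_H has_derivative_continuous continuous_at_imp_continuous_on by blast

lemma segment_deriv:
  assumes "z \<in> Vt"
  shows "((\<lambda>h. H (z + h *\<^sub>R d)) has_real_derivative gradH z \<bullet> d) (at 0)"
proof -
  have "((\<lambda>h. z + h *\<^sub>R d) has_derivative (\<lambda>h. h *\<^sub>R d)) (at (0::real))"
    by (auto intro!: derivative_eq_intros)
  from has_derivative_compose[OF this, of H "\<lambda>h. h \<bullet> gradH z"] has_derivative_H[OF assms]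
  show ?thesis
    by (simp add: has_field_derivative_def inner_commute[of d] mult_commute_abs)
qed

text \<open>If \<open>H b\<close> were above the tangent at \<open>a\<close>, then \<open>H\<close>
  along the segment would fall below the chord just after leaving \<open>a\<close>, against
  concavity.\<close>

lemma supergradient:
  assumes "a \<in> Vt" "b \<in> Vt"
  shows "H b \<le> H a + gradH a \<bullet> (b - a)"
proof (rule ccontr)
  assume neg: "\<not> ?thesis"
  have "((\<lambda>h. H (a + h *\<^sub>R (b - a)) - h * (H b - H a)) has_real_derivative
      gradH a \<bullet> (b - a) - (H b - H a)) (at 0)"
    by (rule derivative_eq_intros segment_deriv[OF assms(1)] refl | simp)+
  moreover have "gradH a \<bullet> (b - a) - (H b - H a) < 0" using neg by simp
  ultimately obtain d where d: "d > 0" "\<And>h. 0 < h \<Longrightarrow> h < d \<Longrightarrow>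
      H (a + h *\<^sub>R (b - a)) - h * (H b - H a) < H a"
    by (force dest: DERIV_neg_dec_right)
  define h where "h = min (d / 2) 1"
  have h: "0 < h" "h < d" "h \<le> 1" using d(1) by (auto simp: h_def)
  have "(1 - h) * H a + h * H b \<le> H ((1 - h) *\<^sub>R a + h *\<^sub>R b)"
    using concave_onD[OF concave_H, of h a b] h assms by simp
  also have "(1 - h) *\<^sub>R a + h *\<^sub>R b = a + h *\<^sub>R (b - a)" by (simp add: algebra_simps)
  finally show False using d(2)[OF h(1,2)] by (simp add: algebra_simps)
qed

text \<open>The sign patterns enter the duality argument only here, in the role of Slater's condition.\<close>

lemma multiplier_eq_0:
  assumes "\<And>n. n \<in> C \<Longrightarrow> a $ n \<le> 0" and "\<And>v. v \<in> V \<Longrightarrow> a \<bullet> v \<le> 0"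
  shows "a = 0"
proof (rule ccontr)
  assume "a \<noteq> 0"
  then obtain m where m: "a $ m \<noteq> 0" by (auto simp: vec_eq_iff)
  \<comment> \<open>The pattern for \<open>F\<close> yields a \<open>v\<close> whose signs agree
    with those of \<open>a\<close> wherever \<open>a\<close> is nonzero, so that
    \<open>a \<bullet> v\<close> has no negative term and a positive one at
    \<open>m\<close>.\<close>
  define F where "F = {n. n \<notin> C \<and> a $ n > 0}"
  have "F \<subseteq> - C" by (auto simp: F_def)
  from sign_patterns[OF this] obtain v where v: "v \<in> V" "\<And>n. n \<in> F \<Longrightarrow> v $ n > 0" "\<And>n. n \<notin> F \<Longrightarrow> v $ n < 0"
    by auto
  have "0 \<le> a $ n * v $ n" for n
    using v(2,3)[of n] assms(1)[of n] by (cases "n \<in> F") (auto simp: F_def intro: mult_nonpos_nonpos)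
  moreover have "0 < a $ m * v $ m"
    using v(2,3)[of m] assms(1)[of m] m by (cases "m \<in> F") (auto simp: F_def intro: mult_neg_neg)
  ultimately have "0 < (\<Sum>n\<in>UNIV. a $ n * v $ n)"
    by (intro sum_pos2[of UNIV m]) auto
  then show False using assms(2)[OF v(1)] by (simp add: inner_vec_def)
qed

text \<open>If \<open>V\<close> missed the cone \<open>P\<close>, a separating normal would be
  nonpositive on the constrained coordinates, where \<open>P\<close> is unbounded below, and
  nonpositive as a functional on \<open>V\<close>, because \<open>0 \<in> P\<close>;
  \<open>multiplier_eq_0\<close> excludes this.\<close>

lemma feasible_nonempty: "primal_feasible C V \<noteq> {}"
proof
  assume empty: "primal_feasible C V = {}"
  define P where "P = {v::real^'n. (\<forall>n\<in>C. v $ n \<le> 0) \<and> (\<forall>n\<in>-C. v $ n = 0)}"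
  have "convex P" unfolding P_def convex_def
    by (auto intro!: add_nonpos_nonpos mult_nonneg_nonpos)
  moreover have "0 \<in> P" by (simp add: P_def)
  moreover have "V \<inter> P = {}" using empty by (auto simp: P_def primal_feasible_def)
  ultimately obtain a b where ab: "a \<noteq> 0" "\<And>v. v \<in> V \<Longrightarrow> a \<bullet> v \<le> b" "\<And>v. v \<in> P \<Longrightarrow> b \<le> a \<bullet> v"
    using separating_hyperplane_sets[OF convex_V, of P] V_nonempty by blast
  have "b \<le> 0" using ab(3)[OF \<open>0 \<in> P\<close>] by simp
  have "a $ n \<le> 0" if "n \<in> C" for n
  proof (rule ccontr)
    assume "\<not> a $ n \<le> 0"
    \<comment> \<open>The coefficient makes the inner product with \<open>a\<close> equal to
      \<open>b - 1\<close>; it is nonpositive because \<open>b \<le> 0\<close>.\<close>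
    have "(((b - 1) / a $ n) *\<^sub>R axis n 1 :: real^'n) \<in> P"
      using that \<open>b \<le> 0\<close> \<open>\<not> a $ n \<le> 0\<close> by (auto simp: P_def axis_def divide_le_0_iff)
    from ab(3)[OF this] \<open>\<not> a $ n \<le> 0\<close> show False
      by (simp add: inner_axis)
  qed
  moreover have "a \<bullet> v \<le> 0" if "v \<in> V" for v using ab(2)[OF that] \<open>b \<le> 0\<close> by simp
  ultimately have "a = 0" by (rule multiplier_eq_0)
  with ab(1) show False by simp
qed

lemma compact_primal_feasible: "compact (primal_feasible C V)"
proof -
  have "primal_feasible C V = V \<inter> ((\<Inter>n\<in>C. {v. v $ n \<le> 0}) \<inter> (\<Inter>n\<in>-C. {v. v $ n = 0}))"
    by (auto simp: primal_feasible_def)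
  moreover have "closed ((\<Inter>n\<in>C. {v::real^'n. v $ n \<le> 0}) \<inter> (\<Inter>n\<in>-C. {v. v $ n = 0}))"
    by (intro closed_Int closed_INT ballI closed_Collect_le closed_Collect_eq continuous_intros)
  ultimately show ?thesis using compact_V compact_Int_closed by auto
qed

lemma primal_optimal_iff:
  "v \<in> primal_optimal C V H \<longleftrightarrow> v \<in> primal_feasible C V \<and> (\<forall>w\<in>primal_feasible C V. H w \<le> H v)"
  by (auto simp: primal_optimal_def is_arg_max_linorder)

lemma primal_optimal_nonempty: "primal_optimal C V H \<noteq> {}"
proof -
  have "continuous_on (primal_feasible C V) H"
    using continuous_on_H V_subset by (rule_tac continuous_on_subset) (auto simp: primal_feasible_def)
  from continuous_attains_sup[OF compact_primal_feasible feasible_nonempty this]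
  show ?thesis using primal_optimal_iff by blast
qed

lemma primal_feasible_imp: "v \<in> primal_feasible C V \<Longrightarrow> v \<in> V"
  by (simp add: primal_feasible_def)

lemma dual_inner_feasible_le_0:
  assumes "y \<in> dual_feasible C" "v \<in> primal_feasible C V"
  shows "y \<bullet> v \<le> 0"
  using assms by (intro inner_vec_le_0[of C]) (auto simp: dual_feasible_def primal_feasible_def)

text \<open>\<open>S\<close> pairs a relaxed constraint level with a value attainable under it.
  Optimality of \<open>vs\<close> keeps \<open>S\<close> apart from the points above
  \<open>(0, H vs)\<close>, and the separating normal \<open>(a, b)\<close> yields the multiplier
  \<open>- a / b\<close> once the hyperplane is known not to be vertical.\<close>

lemma multiplier_exists:
  assumes vs: "vs \<in> primal_optimal C V H"
  obtains y where "y \<in> dual_feasible C" "\<And>v. v \<in> V \<Longrightarrow> H v - y \<bullet> v \<le> H vs"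
proof -
  define S where "S = {ur :: (real^'n) \<times> real. \<exists>v\<in>V. (\<forall>n\<in>C. v $ n \<le> fst ur $ n) \<and>
      (\<forall>n\<in>-C. fst ur $ n = v $ n) \<and> snd ur \<le> H v}"
  define T where "T = {0 :: real^'n} \<times> {H vs<..}"
  have "convex S"
  proof (rule convexI)
    fix p q and s t :: real
    assume "p \<in> S" "q \<in> S" and st: "0 \<le> s" "0 \<le> t" "s + t = 1"
    then obtain v w where v: "v \<in> V" "\<And>n. n \<in> C \<Longrightarrow> v $ n \<le> fst p $ n" "\<And>n. n \<notin> C \<Longrightarrow> fst p $ n = v $ n" "snd p \<le> H v"
      and w: "w \<in> V" "\<And>n. n \<in> C \<Longrightarrow> w $ n \<le> fst q $ n" "\<And>n. n \<notin> C \<Longrightarrow> fst q $ n = w $ n" "snd q \<le> H w"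
      by (auto simp: S_def)
    have "s * H v + t * H w \<le> H (s *\<^sub>R v + t *\<^sub>R w)"
      using concave_H[unfolded concave_on_iff] st subsetD[OF V_subset v(1)] subsetD[OF V_subset w(1)] by blast
    moreover have "s * snd p + t * snd q \<le> s * H v + t * H w"
      using v(4) w(4) st by (intro add_mono mult_left_mono)
    ultimately have "s * snd p + t * snd q \<le> H (s *\<^sub>R v + t *\<^sub>R w)" by simp
    moreover have "s *\<^sub>R v + t *\<^sub>R w \<in> V" using convexD[OF convex_V v(1) w(1) st] .
    ultimately show "s *\<^sub>R p + t *\<^sub>R q \<in> S"
      unfolding S_def using v(2,3) w(2,3) st
      by (auto intro!: bexI[of _ "s *\<^sub>R v + t *\<^sub>R w"] add_mono mult_left_mono)
  qed
  moreover have "convex T" unfolding T_def by (intro convex_Times) auto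
  moreover have "S \<noteq> {}"
    using vs unfolding primal_optimal_iff S_def by (auto intro!: exI[of _ vs] simp: primal_feasible_def)
  moreover have "T \<noteq> {}" by (auto simp: T_def)
  moreover have "S \<inter> T = {}"
    using vs unfolding primal_optimal_iff by (force simp: S_def T_def primal_feasible_def)
  ultimately obtain ab \<beta> where sep: "ab \<noteq> 0" "\<forall>p\<in>S. ab \<bullet> p \<le> \<beta>" "\<forall>p\<in>T. ab \<bullet> p \<ge> \<beta>"
    using separating_hyperplane_sets by metis
  obtain a b where [simp]: "ab = (a, b)" by force
  have S: "a \<bullet> u + b * r \<le> \<beta>"
    if "v \<in> V" "\<And>n. n \<in> C \<Longrightarrow> v $ n \<le> u $ n" "\<And>n. n \<notin> C \<Longrightarrow> u $ n = v $ n" "r \<le> H v" for u v r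
  proof -
    have "(u, r) \<in> S" using that by (auto simp: S_def)
    then show ?thesis using sep(2) by (fastforce simp: inner_Pair)
  qed
  have vsV: "vs \<in> V" using vs by (simp add: primal_optimal_iff primal_feasible_def)
  have T: "\<beta> \<le> b * r" if "r > H vs" for r
  proof -
    have "(0, r) \<in> T" using that by (auto simp: T_def)
    then show ?thesis using sep(3) by (fastforce simp: inner_Pair)
  qed
  have "b \<ge> 0"
  proof (rule ccontr)
    assume "\<not> b \<ge> 0"
    \<comment> \<open>Values may be lowered freely in \<open>S\<close>; this one is so low that a
      negative \<open>b\<close> would violate the separation at \<open>(vs, r)\<close>.\<close>
    define r where "r = - ((\<bar>\<beta> - a \<bullet> vs\<bar> + 1) / - b) - \<bar>H vs\<bar>"
    have "b * r = \<bar>\<beta> - a \<bullet> vs\<bar> + 1 - b * \<bar>H vs\<bar>"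
      using \<open>\<not> b \<ge> 0\<close> by (simp add: r_def field_simps)
    moreover have "b * \<bar>H vs\<bar> \<le> 0" using \<open>\<not> b \<ge> 0\<close> by (intro mult_nonpos_nonneg) auto
    moreover have "r \<le> H vs"
    proof -
      have "(\<bar>\<beta> - a \<bullet> vs\<bar> + 1) / - b \<ge> 0" using \<open>\<not> b \<ge> 0\<close> by (intro divide_nonneg_nonneg) auto
      then show ?thesis unfolding r_def by linarith
    qed
    ultimately show False using S[OF vsV _ _ \<open>r \<le> H vs\<close>, of vs] by simp
  qed
  \<comment> \<open>\<open>T\<close> contains only values strictly above \<open>H vs\<close>; the
    bound at \<open>H vs\<close> itself is a limit.\<close>
  have \<beta>: "\<beta> \<le> b * H vs"
  proof (rule field_le_epsilon)
    fix e :: real assume "e > 0"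
    have "\<beta> \<le> b * (H vs + e / (b + 1))" using \<open>e > 0\<close> \<open>b \<ge> 0\<close> by (intro T) simp
    also have "b * (e / (b + 1)) \<le> e" using \<open>e > 0\<close> \<open>b \<ge> 0\<close> by (simp add: field_simps)
    then have "b * (H vs + e / (b + 1)) \<le> b * H vs + e" by (simp add: algebra_simps)
    finally show "\<beta> \<le> b * H vs + e" .
  qed
  have aC: "a $ n \<le> 0" if "n \<in> C" for n
  proof (rule ccontr)
    assume an: "\<not> a $ n \<le> 0"
    \<comment> \<open>Constraint levels may be raised freely in \<open>S\<close>; raising coordinate
      \<open>n\<close> by \<open>s\<close> would make a positive \<open>a $ n\<close> violate the
      separation.\<close>
    define s where "s = (\<bar>\<beta> - a \<bullet> vs - b * H vs\<bar> + 1) / a $ n"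
    have "s \<ge> 0" using an by (simp add: s_def)
    have "a \<bullet> (vs + s *\<^sub>R axis n 1) + b * H vs \<le> \<beta>"
      using \<open>s \<ge> 0\<close> that by (intro S[OF vsV]) (auto simp: axis_def)
    then show False using an by (simp add: inner_add_right inner_axis s_def)
  qed
  \<comment> \<open>A vertical hyperplane would give
    \<open>a \<bullet> v \<le> \<beta> \<le> 0\<close> on all of \<open>V\<close>.\<close>
  have "b \<noteq> 0"
  proof
    assume "b = 0"
    have "a = 0"
      using S \<beta> \<open>b = 0\<close> by (intro multiplier_eq_0 aC) (fastforce intro: order_trans)+
    then show False using sep(1) \<open>b = 0\<close> by (simp add: zero_prod_def)
  qed
  with \<open>b \<ge> 0\<close> have "b > 0" by simp
  show ?thesis
  proof (rule that[of "(- 1 / b) *\<^sub>R a"])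
    show "(- 1 / b) *\<^sub>R a \<in> dual_feasible C"
      using aC \<open>b > 0\<close> by (auto simp: dual_feasible_def divide_nonpos_pos)
    fix v assume "v \<in> V"
    then have "a \<bullet> v + b * H v \<le> b * H vs" using S[of v v "H v"] \<beta> by simp
    then show "H v - ((- 1 / b) *\<^sub>R a) \<bullet> v \<le> H vs" using \<open>b > 0\<close> by (simp add: field_simps)
  qed
qed

lemma dual_objective_le_iff: "dual_objective V H y \<le> r \<longleftrightarrow> (\<forall>v\<in>V. H v - y \<bullet> v \<le> r)"
proof -
  have "continuous_on V (\<lambda>v. H v - y \<bullet> v)"
    by (intro continuous_intros continuous_on_subset[OF continuous_on_H V_subset])
  then have "compact ((\<lambda>v. H v - y \<bullet> v) ` V)" using compact_V by (rule compact_continuous_image)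
  then have "bdd_above ((\<lambda>v. H v - y \<bullet> v) ` V)" by (intro bounded_imp_bdd_above compact_imp_bounded)
  then show ?thesis unfolding dual_objective_def by (intro cSUP_le_iff V_nonempty)
qed

text \<open>There is no duality gap: weak duality bounds the dual objective below by
  \<open>H vs\<close>, and the multiplier attains this bound. Along trajectories dual optimality is
  used in this saddle form.\<close>

lemma dual_optimal_iff:
  assumes vs: "vs \<in> primal_optimal C V H"
  shows "y \<in> dual_optimal C V H \<longleftrightarrow> y \<in> dual_feasible C \<and> (\<forall>v\<in>V. H v - y \<bullet> v \<le> H vs)"
proof -
  obtain y0 where y0: "y0 \<in> dual_feasible C" "\<And>v. v \<in> V \<Longrightarrow> H v - y0 \<bullet> v \<le> H vs"
    using multiplier_exists[OF vs] by blast
  have weak: "H vs \<le> dual_objective V H z" if "z \<in> dual_feasible C" for z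
  proof -
    have "vs \<in> primal_feasible C V" using vs by (simp add: primal_optimal_iff)
    then have "H vs \<le> H vs - z \<bullet> vs" "vs \<in> V"
      using dual_inner_feasible_le_0[OF that] by (auto simp: primal_feasible_def)
    moreover have "\<forall>v\<in>V. H v - z \<bullet> v \<le> dual_objective V H z"
      using dual_objective_le_iff[of z "dual_objective V H z"] by simp
    ultimately show ?thesis by (meson order_trans)
  qed
  show ?thesis
    unfolding dual_optimal_def is_arg_min_linorder dual_objective_le_iff[symmetric]
    using weak y0(1) y0(2)[folded Ball_def] dual_objective_le_iff[of y0 "H vs"]
    by (auto intro: order_trans)
qed

lemma dual_optimal_nonempty: "dual_optimal C V H \<noteq> {}"
proof -
  obtain vs where vs: "vs \<in> primal_optimal C V H" using primal_optimal_nonempty by blast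
  show ?thesis using multiplier_exists[OF vs] dual_optimal_iff[OF vs] by (metis emptyE)
qed

lemma closed_dual_feasible: "closed (dual_feasible C)"
proof -
  have "dual_feasible C = (\<Inter>n\<in>C. {y::real^'n. 0 \<le> y $ n})" by (auto simp: dual_feasible_def)
  then show ?thesis by (auto intro!: closed_INT closed_Collect_le continuous_intros)
qed

lemma closed_dual_optimal: "closed (dual_optimal C V H)"
proof -
  obtain vs where vs: "vs \<in> primal_optimal C V H" using primal_optimal_nonempty by blast
  have "dual_optimal C V H = dual_feasible C \<inter> (\<Inter>v\<in>V. {y. H v - y \<bullet> v \<le> H vs})"
    using dual_optimal_iff[OF vs] by auto
  moreover have "closed (\<Inter>v\<in>V. {y. H v - y \<bullet> v \<le> H vs})"
    by (intro closed_INT ballI closed_Collect_le continuous_intros)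
  ultimately show ?thesis using closed_dual_feasible by auto
qed

text \<open>Feasibility gives one inequality, the saddle inequality at \<open>v = vs\<close> the
  other.\<close>

lemma complementary_slackness:
  assumes "vs \<in> primal_optimal C V H" "y \<in> dual_optimal C V H"
  shows "y \<bullet> vs = 0"
  using assms dual_optimal_iff[OF assms(1)] dual_inner_feasible_le_0[of y vs] primal_feasible_imp
  by (fastforce simp: primal_optimal_iff)

text \<open>Along the segment from \<open>vs\<close> to \<open>z\<close> the Lagrangian cannot
  increase to first order, so \<open>gradH vs \<bullet> (z - vs) \<le> y \<bullet> z\<close>, and
  the supergradient inequality at \<open>vs\<close> is tight at \<open>z\<close>. Hence
  \<open>H w - gradH vs \<bullet> w\<close> is maximal over the open set \<open>Vt\<close> at
  \<open>w = z\<close>, and its gradient vanishes there.\<close>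

lemma lagrangian_maximizer_gradient:
  assumes vs: "vs \<in> primal_optimal C V H" and y: "y \<in> dual_optimal C V H"
    and z: "z \<in> V" "H vs \<le> H z - y \<bullet> z"
  shows "gradH z = gradH vs" and "H z = H vs + gradH vs \<bullet> (z - vs)"
proof -
  have vsV: "vs \<in> V" using vs by (simp add: primal_optimal_iff primal_feasible_def)
  have yv: "y \<bullet> vs = 0" using complementary_slackness[OF vs y] .
  have max: "H v - y \<bullet> v \<le> H vs" if "v \<in> V" for v using y dual_optimal_iff[OF vs] that by blast
  have "(gradH vs - y) \<bullet> (z - vs) \<le> 0"
  proof (rule ccontr)
    assume neg: "\<not> ?thesis"
    have "((\<lambda>h. H (vs + h *\<^sub>R (z - vs)) - y \<bullet> (vs + h *\<^sub>R (z - vs))) has_real_derivative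
        (gradH vs - y) \<bullet> (z - vs)) (at 0)"
      by (rule derivative_eq_intros segment_deriv[OF subsetD[OF V_subset vsV]] refl
          | simp add: inner_add_right inner_diff_left)+
    moreover have "(gradH vs - y) \<bullet> (z - vs) > 0" using neg by simp
    ultimately obtain d where d: "d > 0" "\<And>h. 0 < h \<Longrightarrow> h < d \<Longrightarrow>
        H vs - y \<bullet> vs < H (vs + h *\<^sub>R (z - vs)) - y \<bullet> (vs + h *\<^sub>R (z - vs))"
      by (force dest: DERIV_pos_inc_right)
    define h where "h = min (d / 2) 1"
    have h: "0 < h" "h < d" "h \<le> 1" using d(1) by (auto simp: h_def)
    have "vs + h *\<^sub>R (z - vs) = (1 - h) *\<^sub>R vs + h *\<^sub>R z" by (simp add: algebra_simps)
    then have "vs + h *\<^sub>R (z - vs) \<in> V"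
      using convexD[OF convex_V vsV z(1), of "1 - h" h] h by simp
    from max[OF this] d(2)[OF h(1,2)] yv show False by simp
  qed
  then have le: "gradH vs \<bullet> (z - vs) \<le> y \<bullet> z" using yv by (simp add: algebra_simps)
  have "H z \<le> H vs + gradH vs \<bullet> (z - vs)" using supergradient V_subset vsV z(1) by blast
  then show eq: "H z = H vs + gradH vs \<bullet> (z - vs)" using le z(2) by simp
  define g where "g w = H w - gradH vs \<bullet> w" for w
  have zVt: "z \<in> Vt" using z(1) V_subset by blast
  have "(g has_derivative (\<lambda>h. h \<bullet> gradH z - gradH vs \<bullet> h)) (at z)"
    unfolding g_def by (intro has_derivative_diff has_derivative_H[OF zVt] derivative_intros)
  moreover have "\<forall>w\<in>Vt. g w \<le> g z"
  proof
    fix w assume "w \<in> Vt"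
    then have "H w \<le> H vs + gradH vs \<bullet> (w - vs)" using supergradient V_subset vsV by blast
    then show "g w \<le> g z" using eq by (simp add: g_def algebra_simps)
  qed
  ultimately have "(\<lambda>h. h \<bullet> gradH z - gradH vs \<bullet> h) = (\<lambda>h. 0)"
    using differential_zero_maxmin[OF zVt open_Vt] by blast
  then have "(gradH z - gradH vs) \<bullet> (gradH z - gradH vs) = 0"
    by (metis inner_commute inner_diff_left)
  then show "gradH z = gradH vs" by simp
qed

end

section \<open>The Lyapunov function\<close>

lemma exp_minus_lipschitz_on: "1-lipschitz_on {0..} (\<lambda>t::real. exp (- t))"
proof (rule lipschitz_onI)
  have *: "\<bar>exp (- s) - exp (- t)\<bar> \<le> t - s" if "0 \<le> s" "s \<le> t" for s t :: real
  proof -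
    have "exp (- s) * (1 + (s - t)) \<le> exp (- s) * exp (s - t)"
      by (intro mult_left_mono exp_ge_add_one_self) auto
    then have "exp (- s) - exp (- t) \<le> exp (- s) * (t - s)"
      by (simp add: mult_exp_exp algebra_simps)
    also have "\<dots> \<le> 1 * (t - s)" using that by (intro mult_right_mono) auto
    finally show ?thesis using that by simp
  qed
  fix s t :: real assume "s \<in> {0..}" "t \<in> {0..}"
  then show "dist (exp (- s)) (exp (- t)) \<le> 1 * dist s t"
    using *[of s t] *[of t s] by (cases "s \<le> t") (auto simp: dist_real_def abs_minus_commute)
qed simp

lemma lipschitz_on_inner_const:
  assumes "L-lipschitz_on S f"
  shows "(L * norm u)-lipschitz_on S (\<lambda>t. f t \<bullet> u)"
proof (rule lipschitz_onI)
  fix s t assume st: "s \<in> S" "t \<in> S"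
  have "dist (f s \<bullet> u) (f t \<bullet> u) \<le> norm (f s - f t) * norm u"
    using Cauchy_Schwarz_ineq2[of "f s - f t" u] by (simp add: dist_real_def inner_diff_left)
  also have "\<dots> \<le> L * dist s t * norm u"
    using lipschitz_onD[OF assms st] by (intro mult_right_mono) (auto simp: dist_norm)
  finally show "dist (f s \<bullet> u) (f t \<bullet> u) \<le> L * norm u * dist s t" by (simp add: mult_ac)
qed (intro mult_nonneg_nonneg lipschitz_on_nonneg[OF assms] norm_ge_zero)

lemma lipschitz_on_inner_self:
  fixes f :: "real \<Rightarrow> 'a::real_inner"
  assumes L: "L-lipschitz_on {a..b} f"
  shows "\<exists>L'. L'-lipschitz_on {a..b} (\<lambda>t. f t \<bullet> f t)"
proof -
  have "bounded (f ` {a..b})"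
    using lipschitz_on_continuous_on[OF L] by (intro compact_imp_bounded compact_continuous_image) auto
  then obtain M where "M > 0" and M: "\<forall>t\<in>{a..b}. norm (f t) \<le> M" unfolding bounded_pos by auto
  have "(L * (2 * M))-lipschitz_on {a..b} (\<lambda>t. f t \<bullet> f t)"
  proof (rule lipschitz_onI)
    fix s t assume st: "s \<in> {a..b}" "t \<in> {a..b}"
    have "dist (f s \<bullet> f s) (f t \<bullet> f t) = \<bar>(f s - f t) \<bullet> (f s + f t)\<bar>"
      by (simp add: dist_real_def algebra_simps inner_commute)
    also have "\<dots> \<le> norm (f s - f t) * norm (f s + f t)" by (rule Cauchy_Schwarz_ineq2)
    also have "\<dots> \<le> (L * dist s t) * (M + M)"
      using lipschitz_onD[OF L st] M st lipschitz_on_nonneg[OF L]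
      by (intro mult_mono order_trans[OF norm_triangle_ineq] add_mono) (auto simp: dist_norm)
    finally show "dist (f s \<bullet> f s) (f t \<bullet> f t) \<le> L * (2 * M) * dist s t" by (simp add: mult_ac)
  qed (use \<open>M > 0\<close> lipschitz_on_nonneg[OF L] in auto)
  then show ?thesis by blast
qed

lemma abs_inner_le:
  fixes a b :: "'a::real_inner"
  assumes "norm a \<le> A" "norm b \<le> B"
  shows "\<bar>a \<bullet> b\<bar> \<le> A * B"
proof -
  have "0 \<le> A" using assms(1) norm_ge_zero[of a] by linarith
  with assms have "norm a * norm b \<le> A * B" by (intro mult_mono norm_ge_zero)
  then show ?thesis using Cauchy_Schwarz_ineq2[of a b] by linarith
qed

text \<open>\<open>X\<close> contains \<open>V\<close> and the starting points considered; being
  convex, it retains every trajectory that starts in it, so \<open>R\<close> and \<open>G\<close>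
  are common to all of them.\<close>

locale egpd_region = egpd_problem +
  fixes X :: "(real ^ 'a) set" and R G :: real and vs :: "real ^ 'a"
  assumes compact_X: "compact X" and convex_X: "convex X" and V_X: "V \<subseteq> X" and X_Vt: "X \<subseteq> Vt"
    and norm_X: "\<And>z. z \<in> X \<Longrightarrow> norm z \<le> R"
    and norm_gradH: "\<And>z. z \<in> X \<Longrightarrow> norm (gradH z) \<le> G"
    and vs_optimal: "vs \<in> primal_optimal C V H"
begin

lemma vs_V: "vs \<in> V"
  using vs_optimal by (simp add: primal_optimal_iff primal_feasible_def)

lemma vs_X: "vs \<in> X"
  using vs_V V_X by blast

lemma norm_V: "w \<in> V \<Longrightarrow> norm w \<le> R"
  using V_X norm_X by blast

lemma R_nonneg: "0 \<le> R"
  using norm_X[OF vs_X] norm_ge_zero[of vs] by linarith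

lemma G_nonneg: "0 \<le> G"
  using norm_gradH[OF vs_X] norm_ge_zero[of "gradH vs"] by linarith

lemma inner_vs_le_0: "y \<in> dual_feasible C \<Longrightarrow> y \<bullet> vs \<le> 0"
  using vs_optimal by (intro dual_inner_feasible_le_0) (simp_all add: primal_optimal_iff)

lemma H_diff_le:
  assumes "a \<in> X" "b \<in> X"
  shows "H b - H a \<le> G * norm (b - a)"
proof -
  have "H b - H a \<le> gradH a \<bullet> (b - a)"
    using supergradient[OF subsetD[OF X_Vt assms(1)] subsetD[OF X_Vt assms(2)]] by simp
  also have "\<dots> \<le> G * norm (b - a)" using abs_inner_le[OF norm_gradH[OF assms(1)], of "b - a" "norm (b - a)"] by simp
  finally show ?thesis .
qed

lemma H_lipschitz: "G-lipschitz_on X H"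
proof (rule lipschitz_onI[OF _ G_nonneg])
  fix a b assume "a \<in> X" "b \<in> X"
  then show "dist (H a) (H b) \<le> G * dist a b"
    using H_diff_le[of a b] H_diff_le[of b a] by (simp add: dist_real_def dist_norm norm_minus_commute abs_le_iff)
qed

end

text \<open>One negligible set \<open>E\<close> collects all exceptional times, so that differential
  inequalities can be checked pointwise. Only the start is assumed to lie in \<open>X\<close>;
  \<open>x_X\<close> shows that \<open>x\<close> stays there.\<close>

locale egpd_path = egpd_region +
  fixes x q v :: "real \<Rightarrow> real ^ 'a" and E :: "real set"
  assumes negligible_E: "negligible E"
    and ac_x: "\<And>T. 0 \<le> T \<Longrightarrow> abs_continuous_on {0..T} x"
    and ac_q: "\<And>T. 0 \<le> T \<Longrightarrow> abs_continuous_on {0..T} q"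
    and x0: "x 0 \<in> X"
    and q_feasible: "\<And>t. 0 \<le> t \<Longrightarrow> q t \<in> dual_feasible C"
    and v_V: "\<And>t. t \<in> {0..} - E \<Longrightarrow> v t \<in> V"
    and v_max: "\<And>t w. t \<in> {0..} - E \<Longrightarrow> w \<in> V \<Longrightarrow> (gradH (x t) - q t) \<bullet> w \<le> (gradH (x t) - q t) \<bullet> v t"
    and deriv_x: "\<And>t. t \<in> {0..} - E \<Longrightarrow> (x has_vector_derivative v t - x t) (at t within {0..})"
    and deriv_q_constrained: "\<And>t n. t \<in> {0..} - E \<Longrightarrow> n \<in> C \<Longrightarrow>
      ((\<lambda>s. q s $ n) has_real_derivative pos_part_at (q t $ n) (v t $ n)) (at t within {0..})"
    and deriv_q_free: "\<And>t n. t \<in> {0..} - E \<Longrightarrow> n \<notin> C \<Longrightarrow>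
      ((\<lambda>s. q s $ n) has_real_derivative v t $ n) (at t within {0..})"
begin

definition q' :: "real \<Rightarrow> real ^ 'a" where
  "q' t = (\<chi> n. if n \<in> C then pos_part_at (q t $ n) (v t $ n) else v t $ n)"

lemma deriv_q:
  assumes "t \<in> {0..} - E"
  shows "(q has_vector_derivative q' t) (at t within {0..})"
  unfolding has_vector_derivative_def
proof (rule has_derivative_componentwise_within[THEN iffD2], rule ballI)
  fix i :: "real ^ 'a" assume "i \<in> Basis"
  then obtain n where i: "i = axis n 1" by (auto simp: Basis_vec_def)
  have "((\<lambda>s. q s $ n) has_real_derivative q' t $ n) (at t within {0..})"
    using deriv_q_constrained[OF assms, of n] deriv_q_free[OF assms, of n] by (simp add: q'_def)
  then show "((\<lambda>s. q s \<bullet> i) has_derivative (\<lambda>h. (h *\<^sub>R q' t) \<bullet> i)) (at t within {0..})"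
    by (simp add: i inner_axis has_field_derivative_def mult_commute_abs)
qed

lemma norm_q': "norm (q' t) \<le> norm (v t)"
  by (rule norm_le_componentwise_cart) (auto simp: q'_def pos_part_at_def)

lemma q'_ge: "v t $ n \<le> q' t $ n"
  by (auto simp: q'_def pos_part_at_def)

lemma q'_eq: "n \<notin> C \<or> 0 < q t $ n \<Longrightarrow> q' t $ n = v t $ n"
  by (auto simp: q'_def pos_part_at_def)

text \<open>Where \<open>q'\<close> and \<open>v\<close> differ,
  \<open>q t $ n = 0 \<le> y $ n\<close> and \<open>q'\<close> exceeds \<open>v\<close>: reflection
  never moves \<open>q\<close> away from a feasible point.\<close>

lemma inner_q'_le:
  assumes "0 \<le> t" "y \<in> dual_feasible C"
  shows "(q t - y) \<bullet> q' t \<le> (q t - y) \<bullet> v t"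
  unfolding inner_vec_def
proof (rule sum_mono)
  fix n
  show "(q t - y) $ n \<bullet> q' t $ n \<le> (q t - y) $ n \<bullet> v t $ n"
  proof (cases "n \<notin> C \<or> 0 < q t $ n")
    case True then show ?thesis using q'_eq by simp
  next
    case False
    then have "q t $ n = 0" "0 \<le> y $ n"
      using q_feasible[OF assms(1)] assms(2) by (auto simp: dual_feasible_def not_less intro: antisym)
    then show ?thesis using q'_ge[of t n] by (auto intro: mult_left_mono)
  qed
qed

lemma subinterval_deriv:
  "0 \<le> a \<Longrightarrow> (f has_vector_derivative d) (at t within {0..}) \<Longrightarrow> (f has_vector_derivative d) (at t within {a..b})"
  for a b :: real
  by (erule has_vector_derivative_within_subset) auto

text \<open>A constant depending on \<open>T\<close> is enough to start
  \<open>exp_comparison\<close>; the uniform constant of \<open>lipschitz_x\<close> has to wait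
  until \<open>x\<close> is known to stay in \<open>X\<close>.\<close>

lemma lipschitz_x_local:
  assumes "0 \<le> T"
  shows "\<exists>L. L-lipschitz_on {0..T} x"
proof -
  have "bounded (x ` {0..T})"
    using abs_continuous_on_imp_continuous_on[OF ac_x[OF assms]]
    by (intro compact_imp_bounded compact_continuous_image) auto
  then obtain M where "M > 0" and M: "\<forall>t\<in>{0..T}. norm (x t) \<le> M" unfolding bounded_pos by auto
  have "(R + M)-lipschitz_on {0..T} x"
  proof (rule abs_continuous_bounded_deriv_imp_lipschitz[OF ac_x[OF assms] negligible_E])
    fix t assume t: "t \<in> {0..T} - E"
    then have "norm (v t - x t) \<le> R + M"
      using M norm_V[OF v_V[of t]] norm_triangle_ineq4[of "v t" "x t"] by force
    then show "\<exists>d. (x has_vector_derivative d) (at t within {0..T}) \<and> norm d \<le> R + M"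
      using deriv_x[of t] t subinterval_deriv[of 0 x "v t - x t" t T] by auto
  qed (use \<open>M > 0\<close> R_nonneg in auto)
  then show ?thesis ..
qed

text \<open>Variation of constants makes \<open>u\<close> a weighted average of the past
  \<open>v\<close>. Instead of integrating \<open>v\<close>, the proof solves for \<open>u\<close>
  and separates it from \<open>V\<close>: by \<open>exp_comparison\<close>, a half-space containing
  \<open>V\<close> attracts \<open>x\<close> at the rate that puts \<open>u\<close> inside
  it.\<close>

lemma x_decomposition:
  assumes "0 \<le> t"
  obtains u where "u \<in> V" "x t = exp (- t) *\<^sub>R x 0 + (1 - exp (- t)) *\<^sub>R u"
proof (cases "t = 0")
  case True
  then show ?thesis using that[OF vs_V] by simp
next
  case False
  then have t: "t > 0" "1 - exp (- t) > 0" using assms by auto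
  define u where "u = (1 / (1 - exp (- t))) *\<^sub>R (x t - exp (- t) *\<^sub>R x 0)"
  have u: "(1 - exp (- t)) *\<^sub>R u = x t - exp (- t) *\<^sub>R x 0" using t by (simp add: u_def)
  have "u \<in> V"
  proof (rule ccontr)
    assume "u \<notin> V"
    then obtain a b where ab: "a \<bullet> u < b" "\<And>w. w \<in> V \<Longrightarrow> b < a \<bullet> w"
      using separating_hyperplane_closed_point[OF convex_V closed_V] by blast
    obtain L where L: "L-lipschitz_on {0..t} x" using lipschitz_x_local[OF assms] by blast
    have "exp (0 - t) * (x 0 \<bullet> a - b) \<le> x t \<bullet> a - b"
    proof (rule exp_comparison[OF lipschitz_on_inner_const[OF L] assms negligible_E])
      fix s assume s: "s \<in> {0..t} - E"
      have "((\<lambda>r. x r \<bullet> a) has_real_derivative (v s - x s) \<bullet> a) (at s within {0..t})"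
        using deriv_x[of s] s by (intro has_real_derivative_inner_left subinterval_deriv) auto
      moreover have "b - x s \<bullet> a \<le> (v s - x s) \<bullet> a"
        using ab(2)[OF v_V[of s]] s by (simp add: inner_diff_right inner_commute[of _ a])
      ultimately show "\<exists>d\<ge>b - x s \<bullet> a. ((\<lambda>r. x r \<bullet> a) has_real_derivative d) (at s within {0..t})" by blast
    qed
    then have "(1 - exp (- t)) * b \<le> ((1 - exp (- t)) *\<^sub>R u) \<bullet> a"
      unfolding u by (simp add: algebra_simps)
    then have "b \<le> a \<bullet> u" using t(2) by (simp add: inner_commute)
    then show False using ab(1) by simp
  qed
  then show ?thesis using that[of u] u by simp
qed

lemma x_X:
  assumes "0 \<le> t"
  shows "x t \<in> X"
proof -
  obtain u where u: "u \<in> V" "x t = exp (- t) *\<^sub>R x 0 + (1 - exp (- t)) *\<^sub>R u"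
    using x_decomposition[OF assms] .
  then show ?thesis using convexD[OF convex_X x0, of u "exp (- t)" "1 - exp (- t)"] V_X assms by auto
qed

lemma x_near_V:
  assumes "0 \<le> t"
  obtains u where "u \<in> V" "norm (x t - u) \<le> 2 * R * exp (- t)"
proof -
  obtain u where u: "u \<in> V" "x t = exp (- t) *\<^sub>R x 0 + (1 - exp (- t)) *\<^sub>R u"
    using x_decomposition[OF assms] .
  have "x t - u = exp (- t) *\<^sub>R (x 0 - u)" unfolding u(2) by (simp add: algebra_simps)
  moreover have "norm (x 0 - u) \<le> R + R"
    using norm_X[OF x0] norm_V[OF u(1)] norm_triangle_ineq4[of "x 0" u] by linarith
  ultimately show ?thesis using that[OF u(1)] by (simp add: mult.commute)
qed

lemma infdist_x_V: "0 \<le> t \<Longrightarrow> infdist (x t) V \<le> 2 * R * exp (- t)"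
  using x_near_V[of t] infdist_le2[of _ V "x t"] by (metis dist_norm)

lemma lipschitz_x:
  assumes "0 \<le> a"
  shows "(2 * R)-lipschitz_on {a..b} x"
proof (cases "a \<le> b")
  case True
  show ?thesis
  proof (rule abs_continuous_bounded_deriv_imp_lipschitz[OF _ negligible_E])
    show "abs_continuous_on {a..b} x"
      using assms True by (intro abs_continuous_on_subset[OF ac_x[of b]]) auto
    fix t assume t: "t \<in> {a..b} - E"
    then have "norm (v t - x t) \<le> 2 * R"
      using norm_X[OF x_X[of t]] norm_V[OF v_V[of t]] norm_triangle_ineq4[of "v t" "x t"] assms by force
    then show "\<exists>d. (x has_vector_derivative d) (at t within {a..b}) \<and> norm d \<le> 2 * R"
      using deriv_x[of t] t assms subinterval_deriv[of a x "v t - x t" t b] by auto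
  qed (use R_nonneg in simp)
qed (use R_nonneg in auto)

lemma lipschitz_q:
  assumes "0 \<le> a"
  shows "R-lipschitz_on {a..b} q"
proof (cases "a \<le> b")
  case True
  show ?thesis
  proof (rule abs_continuous_bounded_deriv_imp_lipschitz[OF _ negligible_E])
    show "abs_continuous_on {a..b} q"
      using assms True by (intro abs_continuous_on_subset[OF ac_q[of b]]) auto
    fix t assume t: "t \<in> {a..b} - E"
    then have "norm (q' t) \<le> R"
      using norm_V[OF v_V[of t]] norm_q'[of t] assms by force
    then show "\<exists>d. (q has_vector_derivative d) (at t within {a..b}) \<and> norm d \<le> R"
      using deriv_q[of t] t assms subinterval_deriv[of a q "q' t" t b] by auto
  qed (use R_nonneg in simp)
qed (use R_nonneg in auto)

text \<open>\<open>H vs\<close> bounds the Lagrangian on \<open>V\<close> only. The extra term is a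
  bound for the distance from \<open>x t\<close> to a point of \<open>V\<close>, times a Lipschitz
  constant of the Lagrangian.\<close>

lemma lagrangian_upper:
  assumes y: "y \<in> dual_optimal C V H" and t: "0 \<le> t"
  shows "H (x t) - y \<bullet> x t \<le> H vs + 2 * R * (G + norm y) * exp (- t)"
proof -
  obtain u where u: "u \<in> V" "norm (x t - u) \<le> 2 * R * exp (- t)" using x_near_V[OF t] .
  have "H u - y \<bullet> u \<le> H vs" using y u(1) dual_optimal_iff[OF vs_optimal] by blast
  moreover have "H (x t) - H u \<le> G * (2 * R * exp (- t))"
    using H_diff_le[of u "x t"] u V_X x_X[OF t] mult_left_mono[OF u(2) G_nonneg] by auto
  moreover have "- (y \<bullet> (x t - u)) \<le> norm y * (2 * R * exp (- t))"
    using abs_inner_le[OF order_refl u(2), of y] by simp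
  ultimately show ?thesis by (simp add: algebra_simps)
qed

text \<open>The last term is the excess allowed by \<open>lagrangian_upper\<close>. Subtracting it
  keeps \<open>\<Phi> y\<close> below \<open>H vs\<close>, and its derivative compensates for a
  Lagrangian value above \<open>H vs\<close>, so that \<open>\<Phi> y\<close> is truly
  nondecreasing.\<close>

definition \<Phi> :: "real ^ 'a \<Rightarrow> real \<Rightarrow> real" where
  "\<Phi> y t = H (x t) - y \<bullet> x t - (q t - y) \<bullet> (q t - y) / 2 - 2 * R * (G + norm y) * exp (- t)"

lemma lipschitz_\<Phi>:
  assumes "0 \<le> a"
  shows "\<exists>L. L-lipschitz_on {a..b} (\<Phi> y)"
proof -
  have "(G * (2 * R))-lipschitz_on {a..b} (\<lambda>t. H (x t))"
    using assms x_X by (intro lipschitz_on_compose2[OF lipschitz_x[OF assms]] lipschitz_on_subset[OF H_lipschitz]) auto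
  moreover have "(2 * R * norm y)-lipschitz_on {a..b} (\<lambda>t. y \<bullet> x t)"
    using lipschitz_on_inner_const[OF lipschitz_x[OF assms, of b], of y] by (simp add: inner_commute)
  moreover obtain L where "L-lipschitz_on {a..b} (\<lambda>t. (q t - y) \<bullet> (q t - y))"
    using lipschitz_on_inner_self[OF lipschitz_on_diff[OF lipschitz_q[OF assms, of b] lipschitz_on_constant]] by blast
  then have "(1/2 * L)-lipschitz_on {a..b} (\<lambda>t. 1/2 * ((q t - y) \<bullet> (q t - y)))"
    by (intro lipschitz_on_cmult_real_nonneg) auto
  moreover have "(2 * R * (G + norm y) * 1)-lipschitz_on {a..b} (\<lambda>t. 2 * R * (G + norm y) * exp (- t))"
    using assms R_nonneg G_nonneg
    by (intro lipschitz_on_cmult_real_nonneg lipschitz_on_subset[OF exp_minus_lipschitz_on]) auto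
  ultimately have "(G * (2 * R) + 2 * R * norm y + 1/2 * L + 2 * R * (G + norm y) * 1)-lipschitz_on {a..b}
      (\<lambda>t. H (x t) - y \<bullet> x t - 1/2 * ((q t - y) \<bullet> (q t - y)) - 2 * R * (G + norm y) * exp (- t))"
    by (intro lipschitz_on_diff)
  then show ?thesis by (auto simp: \<Phi>_def[abs_def])
qed

text \<open>Apart from the exponential term, the chain rule gives \<open>(gradH (x t) - y) \<bullet>
  (v t - x t) - (q t - y) \<bullet> q' t\<close>. By \<open>inner_q'_le\<close>, \<open>q'\<close>
  may be replaced by \<open>v\<close>; then the terms \<open>y \<bullet> v t\<close> cancel and
  \<open>v_max\<close> admits any \<open>w\<close>.\<close>

lemma deriv_\<Phi>:
  assumes y: "y \<in> dual_feasible C" and t: "t \<in> {0..} - E" and w: "w \<in> V"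
  shows "\<exists>d\<ge>(gradH (x t) - q t) \<bullet> w - (gradH (x t) - y) \<bullet> x t + 2 * R * (G + norm y) * exp (- t).
    (\<Phi> y has_real_derivative d) (at t within {0..})"
proof (intro exI conjI)
  let ?g = "gradH (x t)" and ?c = "2 * R * (G + norm y)"
  have "t \<ge> 0" using t by auto
  have x: "(x has_derivative (\<lambda>h. h *\<^sub>R (v t - x t))) (at t within {0..})"
    using deriv_x[OF t] by (simp add: has_vector_derivative_def)
  have "((\<lambda>s. H (x s)) has_derivative (\<lambda>h. (h *\<^sub>R (v t - x t)) \<bullet> ?g)) (at t within {0..})"
    using has_derivative_compose[OF x has_derivative_H] x_X[OF \<open>t \<ge> 0\<close>] X_Vt by auto
  then have H: "((\<lambda>s. H (x s)) has_real_derivative ?g \<bullet> (v t - x t)) (at t within {0..})"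
    by (simp add: has_field_derivative_def inner_commute mult_commute_abs)
  have yx: "((\<lambda>s. y \<bullet> x s) has_real_derivative y \<bullet> (v t - x t)) (at t within {0..})"
    using has_real_derivative_inner_left[OF deriv_x[OF t], of y] by (simp add: inner_commute)
  have "((\<lambda>s. q s - y) has_vector_derivative q' t) (at t within {0..})"
    using has_vector_derivative_diff[OF deriv_q[OF t] has_vector_derivative_const[of y]] by simp
  then have "((\<lambda>s. (q s - y) \<bullet> (q s - y)) has_derivative
      (\<lambda>h. (q t - y) \<bullet> (h *\<^sub>R q' t) + (h *\<^sub>R q' t) \<bullet> (q t - y))) (at t within {0..})"
    unfolding has_vector_derivative_def by (intro has_derivative_inner)
  then have qq: "((\<lambda>s. (q s - y) \<bullet> (q s - y)) has_real_derivative 2 * ((q t - y) \<bullet> q' t)) (at t within {0..})"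
    unfolding has_field_derivative_def by (rule has_derivative_eq_rhs) (auto simp: inner_commute)
  show "(\<Phi> y has_real_derivative
      ?g \<bullet> (v t - x t) - y \<bullet> (v t - x t) - (q t - y) \<bullet> q' t + ?c * exp (- t)) (at t within {0..})"
    unfolding \<Phi>_def by (rule derivative_eq_intros H yx qq refl | simp)+
  have "(?g - q t) \<bullet> w \<le> (?g - q t) \<bullet> v t" using v_max[OF t w] .
  moreover have "(q t - y) \<bullet> q' t \<le> (q t - y) \<bullet> v t" using inner_q'_le[OF \<open>t \<ge> 0\<close> y] .
  ultimately show "(?g - q t) \<bullet> w - (?g - y) \<bullet> x t + ?c * exp (- t) \<le>
      ?g \<bullet> (v t - x t) - y \<bullet> (v t - x t) - (q t - y) \<bullet> q' t + ?c * exp (- t)"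
    by (simp add: inner_diff_left inner_diff_right)
qed

lemma \<Phi>_increment:
  assumes y: "y \<in> dual_optimal C V H" and st: "0 \<le> s" "s \<le> t"
    and w: "w \<in> V" "\<And>r. r \<in> {s..t} \<Longrightarrow> \<eta> \<le> (gradH (x r) - q r) \<bullet> w - (gradH (x r) - y) \<bullet> x r"
  shows "\<eta> * (t - s) \<le> \<Phi> y t - \<Phi> y s"
proof -
  obtain L where L: "L-lipschitz_on {s..t} (\<Phi> y)" using lipschitz_\<Phi>[OF st(1)] by blast
  have yf: "y \<in> dual_feasible C" using y dual_optimal_iff[OF vs_optimal] by blast
  show ?thesis
  proof (rule lipschitz_deriv_ge_imp_increment_ge[OF L st(2) negligible_E])
    fix r assume r: "r \<in> {s..t} - E"
    then have r0: "r \<in> {0..} - E" using st by auto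
    obtain d where d: "d \<ge> (gradH (x r) - q r) \<bullet> w - (gradH (x r) - y) \<bullet> x r + 2 * R * (G + norm y) * exp (- r)"
      "(\<Phi> y has_real_derivative d) (at r within {0..})"
      using deriv_\<Phi>[OF yf r0 w(1)] by blast
    have "0 \<le> 2 * R * (G + norm y) * exp (- r)" using R_nonneg G_nonneg by simp
    moreover have "\<eta> \<le> (gradH (x r) - q r) \<bullet> w - (gradH (x r) - y) \<bullet> x r" using w(2)[of r] r by simp
    ultimately have "d \<ge> \<eta>" using d(1) by linarith
    moreover have "(\<Phi> y has_real_derivative d) (at r within {s..t})"
      using d(2) by (rule DERIV_subset) (use st in auto)
    ultimately show "\<exists>d\<ge>\<eta>. (\<Phi> y has_real_derivative d) (at r within {s..t})" by blast
  qed
qed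

lemma \<Phi>_mono:
  assumes y: "y \<in> dual_optimal C V H" and st: "0 \<le> s" "s \<le> t"
  shows "\<Phi> y s \<le> \<Phi> y t"
proof -
  obtain L where L: "L-lipschitz_on {s..t} (\<Phi> y)" using lipschitz_\<Phi>[OF st(1)] by blast
  have yf: "y \<in> dual_feasible C" using y dual_optimal_iff[OF vs_optimal] by blast
  have "0 * (t - s) \<le> \<Phi> y t - \<Phi> y s"
  proof (rule lipschitz_deriv_ge_imp_increment_ge[OF L st(2) negligible_E])
    fix r assume r: "r \<in> {s..t} - E"
    then have r0: "r \<in> {0..} - E" "0 \<le> r" using st by auto
    let ?g = "gradH (x r)"
    obtain d where d: "d \<ge> (?g - q r) \<bullet> vs - (?g - y) \<bullet> x r + 2 * R * (G + norm y) * exp (- r)"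
      "(\<Phi> y has_real_derivative d) (at r within {0..})"
      using deriv_\<Phi>[OF yf r0(1) vs_V] by blast
    \<comment> \<open>For \<open>w = vs\<close> the bound is at least
      \<open>H vs - (H (x r) - y \<bullet> x r)\<close> plus the exponential term, which is
      nonnegative by \<open>lagrangian_upper\<close>.\<close>
    have "H vs \<le> H (x r) + ?g \<bullet> (vs - x r)"
      using x_X[OF r0(2)] vs_X X_Vt by (intro supergradient) auto
    moreover have "q r \<bullet> vs \<le> 0" using inner_vs_le_0 q_feasible[OF r0(2)] .
    ultimately have "d \<ge> 0"
      using d(1) lagrangian_upper[OF y r0(2)] by (simp add: inner_diff_left inner_diff_right)
    moreover have "(\<Phi> y has_real_derivative d) (at r within {s..t})"
      using d(2) by (rule DERIV_subset) (use st in auto)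
    ultimately show "\<exists>d\<ge>0. (\<Phi> y has_real_derivative d) (at r within {s..t})" by blast
  qed
  then show ?thesis by simp
qed

lemma \<Phi>_upper:
  assumes "y \<in> dual_optimal C V H" "0 \<le> t"
  shows "\<Phi> y t \<le> H vs - (norm (q t - y))\<^sup>2 / 2"
  using lagrangian_upper[OF assms] by (simp add: \<Phi>_def dot_square_norm)

text \<open>The deficit \<open>H vs - \<Phi> y\<close> dominates half the squared distance from
  \<open>q\<close> to \<open>y\<close>, and it never grows.\<close>

lemma q_stays_near:
  assumes "y \<in> dual_optimal C V H" "0 \<le> s" "s \<le> t"
  shows "(norm (q t - y))\<^sup>2 \<le> 2 * (H vs - \<Phi> y s)"
  using \<Phi>_upper[of y t] \<Phi>_mono[of y s t] assms by simp

lemma lagrangian_stays_large: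
  assumes "y \<in> dual_optimal C V H" "0 \<le> s" "s \<le> t"
  shows "\<Phi> y s \<le> H (x t) - y \<bullet> x t"
proof -
  have "0 \<le> 2 * R * (G + norm y) * exp (- t)" using R_nonneg G_nonneg by simp
  moreover have "0 \<le> (q t - y) \<bullet> (q t - y)" by simp
  ultimately have "\<Phi> y t \<le> H (x t) - y \<bullet> x t" unfolding \<Phi>_def by linarith
  then show ?thesis using \<Phi>_mono[OF assms] by simp
qed

text \<open>Bounds the rise still open to \<open>\<Phi> y\<close> independently of the trajectory.
  The exponential term at time \<open>0\<close> contributes
  \<open>2 * R * G + 2 * R * norm y\<close>, the Lagrangian the other
  \<open>2 * R * G + R * norm y\<close>.\<close>

lemma \<Phi>_0_lower:
  assumes "norm (q 0 - y) \<le> B"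
  shows "H vs - \<Phi> y 0 \<le> 4 * R * G + 3 * R * norm y + B\<^sup>2 / 2"
proof -
  have "norm (vs - x 0) \<le> 2 * R" using norm_X[OF vs_X] norm_X[OF x0] norm_triangle_ineq4[of vs "x 0"] by linarith
  then have "H vs - H (x 0) \<le> 2 * (R * G)"
    using H_diff_le[OF x0 vs_X] mult_left_mono[OF _ G_nonneg, of "norm (vs - x 0)" "2 * R"] by (simp add: mult_ac)
  moreover have "y \<bullet> x 0 \<le> R * norm y"
    using abs_inner_le[OF order_refl norm_X[OF x0], of y] by (simp add: mult.commute)
  moreover have "(q 0 - y) \<bullet> (q 0 - y) \<le> B\<^sup>2" using power_mono[OF assms, of 2] by (simp add: dot_square_norm)
  moreover have "\<Phi> y 0 = H (x 0) - y \<bullet> x 0 - (q 0 - y) \<bullet> (q 0 - y) / 2 - 2 * (R * G) - 2 * (R * norm y)"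
    by (simp add: \<Phi>_def algebra_simps)
  moreover have "4 * R * G + 3 * R * norm y + B\<^sup>2 / 2 = 4 * (R * G) + 3 * (R * norm y) + B\<^sup>2 / 2" by simp
  ultimately show ?thesis by linarith
qed

end

section \<open>Uniform settling\<close>

context egpd_region
begin

text \<open>\<open>g\<close> adds up three defects of a point, namely distance to \<open>V\<close>,
  constraint violation and loss of value, which vanish together only at an optimum.\<close>

lemma near_primal_optimal:
  assumes "\<epsilon> > 0"
  shows "\<exists>\<delta>>0. \<forall>z\<in>X. infdist z V < \<delta> \<longrightarrow> (\<forall>n\<in>C. z $ n < \<delta>) \<longrightarrow> (\<forall>n\<in>-C. \<bar>z $ n\<bar> < \<delta>) \<longrightarrow>
    H vs - \<delta> < H z \<longrightarrow> infdist z (primal_optimal C V H) < \<epsilon>"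
proof -
  define viol where "viol z = (\<Sum>n\<in>UNIV. if n \<in> C then max 0 (z $ n) else \<bar>z $ n\<bar>)" for z :: "real ^ 'a"
  define g where "g z = infdist z V + viol z + max 0 (H vs - H z)" for z
  have "continuous_on X viol"
    unfolding viol_def
  proof (intro continuous_on_sum)
    fix n show "continuous_on X (\<lambda>z. if n \<in> C then max 0 (z $ n) else \<bar>z $ n\<bar>)"
      by (cases "n \<in> C") (auto intro!: continuous_intros)
  qed
  then have "continuous_on X g"
    unfolding g_def by (intro continuous_intros continuous_on_subset[OF continuous_on_H X_Vt])
  moreover have "continuous_on X (\<lambda>z. infdist z (primal_optimal C V H))"
    by (intro continuous_intros)
  moreover have "infdist z (primal_optimal C V H) \<le> 0" if "g z \<le> 0" for z
  proof -
    have nonneg: "0 \<le> infdist z V" "0 \<le> viol z" "0 \<le> max 0 (H vs - H z)"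
      by (auto simp: viol_def infdist_nonneg intro!: sum_nonneg)
    then have zero: "infdist z V = 0" "viol z = 0" "max 0 (H vs - H z) = 0" using that by (simp_all add: g_def)
    have "z \<in> V" using zero(1) in_closed_iff_infdist_zero[OF closed_V V_nonempty] by blast
    have "(if n \<in> C then max 0 (z $ n) else \<bar>z $ n\<bar>) = 0" for n
      using zero(2) unfolding viol_def by (subst (asm) sum_nonneg_eq_0_iff) auto
    then have "(\<forall>n\<in>C. z $ n \<le> 0) \<and> (\<forall>n\<in>-C. z $ n = 0)"
      by (metis ComplD abs_eq_0 max.absorb_iff1)
    then have "z \<in> primal_feasible C V" using \<open>z \<in> V\<close> by (simp add: primal_feasible_def)
    moreover have "H vs \<le> H z" using zero(3) by (simp add: max_def split: if_splits)
    ultimately have "z \<in> primal_optimal C V H"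
      using vs_optimal unfolding primal_optimal_iff by (meson order_trans)
    then show ?thesis by simp
  qed
  ultimately obtain \<delta> where \<delta>: "\<delta> > 0" "\<forall>z\<in>X. g z < \<delta> \<longrightarrow> infdist z (primal_optimal C V H) < \<epsilon>"
    using compact_sublevel_small[OF compact_X _ _ _ assms, of "\<lambda>z. infdist z (primal_optimal C V H)" g] by blast
  \<comment> \<open>One share for each of the \<open>CARD('a)\<close> coordinates, one for the
    distance to \<open>V\<close>, one for the value.\<close>
  define \<delta>' where "\<delta>' = \<delta> / (real CARD('a) + 2)"
  have d': "\<delta>' > 0" "(real CARD('a) + 2) * \<delta>' = \<delta>" using \<delta>(1) by (auto simp: \<delta>'_def add_nonneg_pos)
  show ?thesis
  proof (intro exI[of _ \<delta>'] conjI ballI impI d'(1))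
    fix z assume z: "z \<in> X" "infdist z V < \<delta>'" "\<forall>n\<in>C. z $ n < \<delta>'" "\<forall>n\<in>-C. \<bar>z $ n\<bar> < \<delta>'" "H vs - \<delta>' < H z"
    have "viol z \<le> real (card (UNIV :: 'a set)) * \<delta>'"
      unfolding viol_def by (intro sum_bounded_above) (use z(3,4) d'(1) in \<open>auto intro: less_imp_le\<close>)
    moreover have "max 0 (H vs - H z) < \<delta>'" using z(5) d'(1) by simp
    ultimately have "g z < \<delta>' + real CARD('a) * \<delta>' + \<delta>'" using z(2) unfolding g_def by linarith
    also have "\<dots> = \<delta>" using d'(2) by (simp add: algebra_simps)
    finally show "infdist z (primal_optimal C V H) < \<epsilon>" using \<delta>(2) z(1) by blast
  qed
qed

lemma dual_objective_lipschitz: "R-lipschitz_on UNIV (dual_objective V H)"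
proof -
  have *: "dual_objective V H y \<le> dual_objective V H z + R * norm (y - z)" for y z
    unfolding dual_objective_le_iff
  proof
    fix w assume w: "w \<in> V"
    have "H w - z \<bullet> w \<le> dual_objective V H z" using dual_objective_le_iff[of z "dual_objective V H z"] w by simp
    moreover have "- ((y - z) \<bullet> w) \<le> norm (y - z) * R" using abs_inner_le[OF order_refl norm_V[OF w], of "y - z"] by linarith
    ultimately show "H w - y \<bullet> w \<le> dual_objective V H z + R * norm (y - z)"
      by (simp add: inner_diff_left mult.commute)
  qed
  show ?thesis
  proof (rule lipschitz_onI[OF _ R_nonneg])
    fix y z
    show "dist (dual_objective V H y) (dual_objective V H z) \<le> R * dist y z"
      using *[of y z] *[of z y] by (simp add: dist_real_def dist_norm norm_minus_commute abs_le_iff)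
  qed
qed

text \<open>The bound \<open>Q\<close> supplies the compactness; \<open>q\<close> obeys such a bound
  by \<open>q_stays_near\<close>.\<close>

lemma near_dual_optimal:
  assumes "\<epsilon> > 0"
  shows "\<exists>\<delta>>0. \<forall>y\<in>dual_feasible C. norm y \<le> Q \<longrightarrow> (\<forall>w\<in>V. H w - y \<bullet> w \<le> H vs + \<delta>) \<longrightarrow>
    (\<exists>z\<in>dual_optimal C V H. norm (y - z) \<le> \<epsilon>)"
proof -
  define S where "S = dual_feasible C \<inter> cball (0 :: real ^ 'a) Q"
  have "compact S" unfolding S_def using closed_dual_feasible by (simp add: closed_Int_compact)
  moreover have "continuous_on S (\<lambda>y. infdist y (dual_optimal C V H))" by (intro continuous_intros)
  moreover have "continuous_on S (\<lambda>y. dual_objective V H y - H vs)"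
    by (intro continuous_intros continuous_on_subset[OF lipschitz_on_continuous_on[OF dual_objective_lipschitz]]) auto
  moreover have "infdist y (dual_optimal C V H) \<le> 0" if "y \<in> S" "dual_objective V H y - H vs \<le> 0" for y
    using that dual_optimal_iff[OF vs_optimal] dual_objective_le_iff[of y "H vs"] by (simp add: S_def)
  ultimately obtain \<delta> where \<delta>: "\<delta> > 0"
    "\<forall>y\<in>S. dual_objective V H y - H vs < \<delta> \<longrightarrow> infdist y (dual_optimal C V H) < \<epsilon>"
    using compact_sublevel_small[OF _ _ _ _ assms, of S "\<lambda>y. infdist y (dual_optimal C V H)" "\<lambda>y. dual_objective V H y - H vs"]
    by blast
  show ?thesis
  proof (intro exI[of _ "\<delta> / 2"] conjI ballI impI)
    fix y assume y: "y \<in> dual_feasible C" "norm y \<le> Q" "\<forall>w\<in>V. H w - y \<bullet> w \<le> H vs + \<delta> / 2"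
    then have "dual_objective V H y \<le> H vs + \<delta> / 2" by (simp add: dual_objective_le_iff)
    then have "infdist y (dual_optimal C V H) < \<epsilon>" using \<delta> y by (simp add: S_def)
    moreover obtain z where "z \<in> dual_optimal C V H" "infdist y (dual_optimal C V H) = dist y z"
      using infdist_attains_inf[OF closed_dual_optimal dual_optimal_nonempty] by blast
    ultimately show "\<exists>z\<in>dual_optimal C V H. norm (y - z) \<le> \<epsilon>" by (auto simp: dist_norm intro!: bexI[of _ z])
  qed (use \<delta>(1) in simp)
qed

text \<open>The quantitative form, by compactness, of
  \<open>lagrangian_maximizer_gradient\<close>.\<close>

lemma near_lagrangian_maximizer:
  assumes y: "y \<in> dual_optimal C V H" and "\<epsilon> > 0"
  shows "\<exists>\<delta>>0. \<forall>z\<in>X. infdist z V < \<delta> \<longrightarrow> H vs - \<delta> < H z - y \<bullet> z \<longrightarrow>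
    norm (gradH z - gradH vs) \<le> \<epsilon> \<and> \<bar>H z - H vs - gradH vs \<bullet> (z - vs)\<bar> \<le> \<epsilon>"
proof -
  define f where "f z = norm (gradH z - gradH vs) + \<bar>H z - H vs - gradH vs \<bullet> (z - vs)\<bar>" for z
  define g where "g z = infdist z V + max 0 (H vs - (H z - y \<bullet> z))" for z
  have "continuous_on X f" unfolding f_def
    by (intro continuous_intros continuous_on_subset[OF continuous_on_H X_Vt] continuous_on_subset[OF cont_gradH X_Vt])
  moreover have "continuous_on X g" unfolding g_def
    by (intro continuous_intros continuous_on_subset[OF continuous_on_H X_Vt])
  moreover have "f z \<le> 0" if "g z \<le> 0" for z
  proof -
    have "infdist z V = 0" "max 0 (H vs - (H z - y \<bullet> z)) = 0"
      using that infdist_nonneg[of z V] unfolding g_def by linarith+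
    then have "z \<in> V" "H vs \<le> H z - y \<bullet> z"
      using in_closed_iff_infdist_zero[OF closed_V V_nonempty] by (auto simp: max_def split: if_splits)
    then show ?thesis using lagrangian_maximizer_gradient[OF vs_optimal y, of z] by (simp add: f_def)
  qed
  ultimately obtain \<delta> where \<delta>: "\<delta> > 0" "\<forall>z\<in>X. g z < \<delta> \<longrightarrow> f z < \<epsilon>"
    using compact_sublevel_small[OF compact_X _ _ _ \<open>\<epsilon> > 0\<close>, of f g] by blast
  show ?thesis
  proof (intro exI[of _ "\<delta> / 2"] conjI ballI impI)
    fix z assume z: "z \<in> X" "infdist z V < \<delta> / 2" "H vs - \<delta> / 2 < H z - y \<bullet> z"
    have "max 0 (H vs - (H z - y \<bullet> z)) < \<delta> / 2" using z(3) \<delta>(1) unfolding max_less_iff_conj by linarith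
    then have "g z < \<delta>" using z(2) by (simp add: g_def)
    then have f: "f z < \<epsilon>" using \<delta>(2) z(1) by blast
    show "norm (gradH z - gradH vs) \<le> \<epsilon>"
      using f abs_ge_zero[of "H z - H vs - gradH vs \<bullet> (z - vs)"] unfolding f_def by linarith
    show "\<bar>H z - H vs - gradH vs \<bullet> (z - vs)\<bar> \<le> \<epsilon>"
      using f norm_ge_zero[of "gradH z - gradH vs"] unfolding f_def by linarith
  qed (use \<delta>(1) in simp)
qed

end

section \<open>Estimates on a time window\<close>

context egpd_path
begin

text \<open>
  Subtracting \<open>q - y\<close> from \<open>x\<close> trades the unknown \<open>v\<close> in \<open>x' = v - x\<close> for \<open>v - q'\<close>, which has a sign
  and vanishes in the unreflected coordinates.
\<close>

lemma coordinate_comparison: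
  fixes n :: 'a and y :: "real ^ 'a"
  assumes ab: "0 \<le> a" "a \<le> b" and near: "\<And>t. a \<le> t \<Longrightarrow> t \<le> b \<Longrightarrow> norm (q t - y) \<le> \<theta>"
  shows "x b $ n \<le> 2 * \<theta> + exp (a - b) * R"
    and "(\<And>t. a \<le> t \<Longrightarrow> t \<le> b \<Longrightarrow> q' t $ n = v t $ n) \<Longrightarrow> - (2 * \<theta> + exp (a - b) * R) \<le> x b $ n"
proof -
  define e where "e = (axis n 1 :: real ^ 'a)"
  have e: "z \<bullet> e = z $ n" for z :: "real ^ 'a" by (simp add: e_def inner_axis)
  define z where "z t = (x t - (q t - y)) \<bullet> e" for t
  have z: "z t = x t $ n - (q t - y) $ n" for t by (simp add: z_def e)
  have qn: "\<bar>(q t - y) $ n\<bar> \<le> \<theta>" if "a \<le> t" "t \<le> b" for t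
    using component_le_norm_cart[of "q t - y" n] near[OF that] by linarith
  have xa: "\<bar>x a $ n\<bar> \<le> R"
    using component_le_norm_cart[of "x a" n] norm_X[OF x_X[OF ab(1)]] by linarith
  obtain L where L: "L-lipschitz_on {a..b} z"
  proof -
    have "(2 * R + (R + 0))-lipschitz_on {a..b} (\<lambda>t. x t - (q t - y))"
      by (intro lipschitz_on_diff lipschitz_x lipschitz_q lipschitz_on_constant ab)
    from lipschitz_on_inner_const[OF this, of e] show ?thesis using that by (simp add: z_def[abs_def])
  qed
  have deriv: "(z has_real_derivative v t $ n - x t $ n - q' t $ n) (at t within {a..b})"
    if "t \<in> {a..b} - E" for t
  proof -
    have t: "t \<in> {0..} - E" using that ab by auto
    have "((\<lambda>s. x s - (q s - y)) has_vector_derivative (v t - x t) - (q' t - 0)) (at t within {0..})"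
      by (intro has_vector_derivative_diff deriv_x[OF t] deriv_q[OF t] has_vector_derivative_const)
    from has_real_derivative_inner_left[OF subinterval_deriv[OF ab(1) this], of e] show ?thesis
      by (simp add: z_def[abs_def] e inner_diff_left)
  qed
  have ex: "exp (a - b) \<le> 1" "0 < exp (a - b)" using ab by auto
  \<comment> \<open>Since \<open>q'\<close> dominates \<open>v\<close>, \<open>z\<close> decreases
    at least at the rate \<open>z - \<theta>\<close>. One \<open>\<theta>\<close> compares
    \<open>z\<close> with \<open>x\<close> in this rate, the other at the final time.\<close>
  have "exp (a - b) * (- z a - - \<theta>) \<le> - z b - - \<theta>"
  proof (rule exp_comparison[OF _ ab(2) negligible_E])
    show "L-lipschitz_on {a..b} (\<lambda>t. - z t)" using L by simp
    fix t assume t: "t \<in> {a..b} - E"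
    have "((\<lambda>t. - z t) has_real_derivative - (v t $ n - x t $ n - q' t $ n)) (at t within {a..b})"
      by (rule DERIV_minus) (rule deriv[OF t])
    moreover have "- \<theta> - - z t \<le> - (v t $ n - x t $ n - q' t $ n)"
      using q'_ge[of t n] qn[of t] t z[of t] by auto
    ultimately show "\<exists>d\<ge>- \<theta> - - z t. ((\<lambda>t. - z t) has_real_derivative d) (at t within {a..b})" by blast
  qed
  moreover have "exp (a - b) * (z a - \<theta>) \<le> exp (a - b) * R"
    using xa qn[of a] ab z[of a] ex by (intro mult_left_mono) auto
  ultimately have "z b \<le> \<theta> + exp (a - b) * R" by (simp add: algebra_simps)
  then show "x b $ n \<le> 2 * \<theta> + exp (a - b) * R" using qn[of b] ab z[of b] by simp
  assume tight: "\<And>t. a \<le> t \<Longrightarrow> t \<le> b \<Longrightarrow> q' t $ n = v t $ n"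
  have "exp (a - b) * (z a - - \<theta>) \<le> z b - - \<theta>"
  proof (rule exp_comparison[OF L ab(2) negligible_E])
    fix t assume t: "t \<in> {a..b} - E"
    have "- \<theta> - z t \<le> v t $ n - x t $ n - q' t $ n"
      using tight[of t] qn[of t] t z[of t] by auto
    then show "\<exists>d\<ge>- \<theta> - z t. (z has_real_derivative d) (at t within {a..b})" using deriv[OF t] by blast
  qed
  moreover have "exp (a - b) * - R \<le> exp (a - b) * (z a + \<theta>)"
    using xa qn[of a] ab z[of a] ex by (intro mult_left_mono) auto
  ultimately have "- \<theta> - exp (a - b) * R \<le> z b" by (simp add: algebra_simps)
  then show "- (2 * \<theta> + exp (a - b) * R) \<le> x b $ n" using qn[of b] ab z[of b] by simp
qed

text \<open>Approximate complementary slackness, used to turn a bound for the Lagrangian into one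
  for \<open>H\<close>. A constrained coordinate with \<open>y $ n \<le> \<theta>\<close>
  contributes at most \<open>\<theta> * R\<close> in absolute value. Any other coordinate is free or
  has \<open>q\<close> positive throughout, so reflection is inactive and
  \<open>coordinate_comparison\<close> bounds \<open>x b $ n\<close> from both sides.\<close>

lemma inner_lower:
  fixes y :: "real ^ 'a"
  assumes y: "y \<in> dual_feasible C" and ab: "0 \<le> a" "a \<le> b"
    and near: "\<And>t. a \<le> t \<Longrightarrow> t \<le> b \<Longrightarrow> norm (q t - y) \<le> \<theta>"
  shows "- (real CARD('a) * (norm y * (2 * \<theta> + exp (a - b) * R) + \<theta> * R)) \<le> y \<bullet> x b"
proof -
  have \<theta>: "0 \<le> \<theta>" using near[of a] ab norm_ge_zero[of "q a - y"] by linarith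
  define \<rho> where "\<rho> = 2 * \<theta> + exp (a - b) * R"
  have \<rho>: "0 \<le> \<rho>" using \<theta> R_nonneg by (simp add: \<rho>_def)
  have "- (norm y * \<rho> + \<theta> * R) \<le> y $ n * x b $ n" for n
  proof -
    have yn: "\<bar>y $ n\<bar> \<le> norm y" by (rule component_le_norm_cart)
    have xn: "\<bar>x b $ n\<bar> \<le> R" using component_le_norm_cart[of "x b" n] norm_X[OF x_X[of b]] ab by linarith
    have up: "x b $ n \<le> \<rho>" using coordinate_comparison(1)[OF ab near] by (simp add: \<rho>_def)
    consider "n \<in> C" "y $ n \<le> \<theta>" | "n \<notin> C \<or> y $ n > \<theta>" by force
    then show ?thesis
    proof cases
      case 1
      then have "0 \<le> y $ n" using y by (simp add: dual_feasible_def)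
      then have "\<bar>y $ n * x b $ n\<bar> \<le> \<theta> * R" unfolding abs_mult using 1 xn by (intro mult_mono) auto
      moreover have "0 \<le> norm y * \<rho>" using \<rho> by simp
      ultimately show ?thesis by linarith
    next
      case 2
      have "q' t $ n = v t $ n" if "a \<le> t" "t \<le> b" for t
      proof (rule q'_eq)
        show "n \<notin> C \<or> 0 < q t $ n"
          using 2 component_le_norm_cart[of "q t - y" n] near[OF that] by auto
      qed
      then have "- \<rho> \<le> x b $ n" using coordinate_comparison(2)[OF ab near] by (simp add: \<rho>_def)
      then have "\<bar>y $ n * x b $ n\<bar> \<le> norm y * \<rho>"
        unfolding abs_mult using up yn by (intro mult_mono) auto
      moreover have "0 \<le> \<theta> * R" using \<theta> R_nonneg by simp
      ultimately show ?thesis by linarith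
    qed
  qed
  then have "(\<Sum>n\<in>(UNIV::'a set). - (norm y * \<rho> + \<theta> * R)) \<le> (\<Sum>n\<in>UNIV. y $ n * x b $ n)"
    by (intro sum_mono)
  then have "real CARD('a) * - (norm y * \<rho> + \<theta> * R) \<le> y \<bullet> x b"
    unfolding sum_constant by (simp only: inner_vec_def inner_real_def)
  then show ?thesis unfolding \<rho>_def[symmetric] by (simp only: mult_minus_right)
qed

text \<open>Exchanging \<open>gradH (x t)\<close> for the fixed \<open>gradH vs\<close> costs
  \<open>\<epsilon> * R\<close> against a vector of norm at most \<open>R\<close>. Afterwards the
  functionals belonging to different times differ only through \<open>q\<close>, and estimates at
  different times can be subtracted.\<close>

lemma near_optimal_window:
  assumes qs: "qs \<in> dual_optimal C V H" and s: "0 \<le> s" and "0 \<le> \<tau>" and "0 \<le> \<epsilon>"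
    and grad: "\<And>t. s \<le> t \<Longrightarrow> t \<le> s + \<tau> \<Longrightarrow> norm (gradH (x t) - gradH vs) \<le> \<epsilon>"
    and lin: "\<And>t. s \<le> t \<Longrightarrow> t \<le> s + \<tau> \<Longrightarrow> \<bar>H (x t) - H vs - gradH vs \<bullet> (x t - vs)\<bar> \<le> \<epsilon>"
    and small: "\<And>t w. s \<le> t \<Longrightarrow> t \<le> s + \<tau> \<Longrightarrow> w \<in> V \<Longrightarrow>
      (gradH (x t) - q t) \<bullet> w - (gradH (x t) - qs) \<bullet> x t \<le> \<epsilon>"
    and decay: "2 * R * (G + norm qs) * exp (- s) \<le> \<epsilon>"
  shows "w \<in> V \<Longrightarrow> H w - q s \<bullet> w \<le> H vs + (2 * R + 3) * \<epsilon>"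
    and "s \<le> t \<Longrightarrow> t \<le> s + \<tau> \<Longrightarrow> (norm (q t - q s))\<^sup>2 \<le> 2 * (4 * R + 3) * \<epsilon> * \<tau>"
    and "\<lbrakk>y \<in> dual_optimal C V H; \<And>t. s \<le> t \<Longrightarrow> t \<le> s + \<tau> \<Longrightarrow> norm (q t - y) \<le> \<delta>\<rbrakk> \<Longrightarrow>
      H vs - ((2 * R + 1) * \<epsilon> + \<delta> * R + exp (- \<tau>) * ((2 * G + norm y) * R)) \<le> H (x (s + \<tau>)) - y \<bullet> x (s + \<tau>)"
proof -
  define p where "p = gradH vs"
  have pdiff: "\<bar>(p - gradH (x t)) \<bullet> z\<bar> \<le> \<epsilon> * R" if "s \<le> t" "t \<le> s + \<tau>" "norm z \<le> R" for t z
    using abs_inner_le[OF _ that(3), of "p - gradH (x t)" \<epsilon>] grad[OF that(1,2)] by (simp add: p_def norm_minus_commute)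
  \<comment> \<open>Two gradient exchanges cost \<open>2 * R * \<epsilon>\<close>; the other three
    \<open>\<epsilon>\<close> come from \<open>small\<close>, \<open>lin\<close> and
    \<open>decay\<close>.\<close>
  have upper: "(p - q t) \<bullet> w \<le> p \<bullet> vs + (2 * R + 3) * \<epsilon>" if t: "s \<le> t" "t \<le> s + \<tau>" and w: "w \<in> V" for t w
  proof -
    have t0: "0 \<le> t" using t s by simp
    have "2 * R * (G + norm qs) * exp (- t) \<le> 2 * R * (G + norm qs) * exp (- s)"
      using t R_nonneg G_nonneg by (intro mult_left_mono) auto
    then have L: "H (x t) - qs \<bullet> x t \<le> H vs + \<epsilon>" using lagrangian_upper[OF qs t0] decay by linarith
    have 1: "(p - q t) \<bullet> w = (gradH (x t) - q t) \<bullet> w + (p - gradH (x t)) \<bullet> w" by (simp add: inner_diff_left)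
    have 2: "(gradH (x t) - qs) \<bullet> x t = p \<bullet> (x t - vs) + p \<bullet> vs - qs \<bullet> x t - (p - gradH (x t)) \<bullet> x t"
      by (simp add: inner_diff_left inner_diff_right)
    have "(2 * R + 3) * \<epsilon> = 2 * (\<epsilon> * R) + 3 * \<epsilon>" by (simp add: algebra_simps)
    then show ?thesis
      using small[OF t w] pdiff[OF t norm_V[OF w]] pdiff[OF t norm_X[OF x_X[OF t0]]] lin[OF t, folded p_def] L 1 2
      by linarith
  qed
  \<comment> \<open>\<open>v t\<close> does at least as well as \<open>vs\<close>, for which
    \<open>q t \<bullet> vs \<le> 0\<close>; again two gradient exchanges.\<close>
  have lower: "p \<bullet> vs - 2 * R * \<epsilon> \<le> (p - q t) \<bullet> v t" if t: "s \<le> t" "t \<le> s + \<tau>" and "t \<notin> E" for t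
  proof -
    have t0: "0 \<le> t" "t \<in> {0..} - E" using t s \<open>t \<notin> E\<close> by auto
    have 1: "(p - q t) \<bullet> v t = (gradH (x t) - q t) \<bullet> v t + (p - gradH (x t)) \<bullet> v t" by (simp add: inner_diff_left)
    have 2: "(gradH (x t) - q t) \<bullet> vs = p \<bullet> vs - q t \<bullet> vs - (p - gradH (x t)) \<bullet> vs" by (simp add: inner_diff_left)
    have "2 * R * \<epsilon> = 2 * (\<epsilon> * R)" by simp
    then show ?thesis
      using v_max[OF t0(2) vs_V] pdiff[OF t norm_V[OF v_V[OF t0(2)]]] pdiff[OF t norm_V[OF vs_V]]
        inner_vs_le_0[OF q_feasible[OF t0(1)]] 1 2
      by linarith
  qed
  show "H w - q s \<bullet> w \<le> H vs + (2 * R + 3) * \<epsilon>" if w: "w \<in> V"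
  proof -
    have "H w \<le> H vs + p \<bullet> (w - vs)"
      unfolding p_def using w V_subset vs_V by (intro supergradient) auto
    then show ?thesis using upper[of s w] w \<open>0 \<le> \<tau>\<close> by (simp add: inner_diff_left inner_diff_right)
  qed
  show "(norm (q t - q s))\<^sup>2 \<le> 2 * (4 * R + 3) * \<epsilon> * \<tau>" if t: "s \<le> t" "t \<le> s + \<tau>"
  proof -
    obtain L where L: "L-lipschitz_on {s..t} (\<lambda>r. (q r - q s) \<bullet> (q r - q s))"
      using lipschitz_on_inner_self[OF lipschitz_on_diff[OF lipschitz_q[OF s, of t] lipschitz_on_constant]] by blast
    have "- (2 * ((4 * R + 3) * \<epsilon>)) * (t - s) \<le> - ((q t - q s) \<bullet> (q t - q s)) - - ((q s - q s) \<bullet> (q s - q s))"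
    proof (rule lipschitz_deriv_ge_imp_increment_ge[OF _ t(1) negligible_E])
      show "L-lipschitz_on {s..t} (\<lambda>r. - ((q r - q s) \<bullet> (q r - q s)))" using L by simp
      fix r assume r: "r \<in> {s..t} - E"
      then have r0: "r \<in> {0..} - E" "s \<le> r" "r \<le> s + \<tau>" "r \<notin> E" "0 \<le> r" using s t by auto
      have "((\<lambda>r. q r - q s) has_vector_derivative q' r) (at r within {s..t})"
        using has_vector_derivative_diff[OF subinterval_deriv[OF s deriv_q[OF r0(1)]] has_vector_derivative_const[of "q s"]] by simp
      then have "((\<lambda>r. (q r - q s) \<bullet> (q r - q s)) has_derivative
          (\<lambda>h. (q r - q s) \<bullet> (h *\<^sub>R q' r) + (h *\<^sub>R q' r) \<bullet> (q r - q s))) (at r within {s..t})"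
        unfolding has_vector_derivative_def by (intro has_derivative_inner)
      then have "((\<lambda>r. (q r - q s) \<bullet> (q r - q s)) has_real_derivative 2 * ((q r - q s) \<bullet> q' r)) (at r within {s..t})"
        unfolding has_field_derivative_def by (rule has_derivative_eq_rhs) (auto simp: inner_commute)
      then have "((\<lambda>r. - ((q r - q s) \<bullet> (q r - q s))) has_real_derivative - (2 * ((q r - q s) \<bullet> q' r))) (at r within {s..t})"
        by (rule DERIV_minus)
      moreover have "(q r - q s) \<bullet> q' r \<le> (4 * R + 3) * \<epsilon>"
      proof -
        have "(q r - q s) \<bullet> q' r \<le> (q r - q s) \<bullet> v r" using inner_q'_le[OF r0(5) q_feasible[OF s]] .
        \<comment> \<open>The crux: \<open>upper\<close> at the initial time \<open>s\<close> is
          tested with the later \<open>v r\<close>, while \<open>lower\<close> belongs to time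
          \<open>r\<close>.\<close>
        also have "\<dots> = (p - q s) \<bullet> v r - (p - q r) \<bullet> v r" by (simp add: inner_diff_left)
        also have "\<dots> \<le> (2 * R + 3) * \<epsilon> + 2 * R * \<epsilon>"
          using upper[OF order_refl _ v_V[OF r0(1)]] lower[OF r0(2,3,4)] \<open>0 \<le> \<tau>\<close> by simp
        finally show ?thesis by (simp add: algebra_simps)
      qed
      ultimately show "\<exists>d\<ge>- (2 * ((4 * R + 3) * \<epsilon>)).
          ((\<lambda>r. - ((q r - q s) \<bullet> (q r - q s))) has_real_derivative d) (at r within {s..t})"
        by (intro exI[of _ "- (2 * ((q r - q s) \<bullet> q' r))"]) auto
    qed
    then have "(norm (q t - q s))\<^sup>2 \<le> 2 * ((4 * R + 3) * \<epsilon>) * (t - s)" by (simp add: dot_square_norm)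
    also have "\<dots> \<le> 2 * ((4 * R + 3) * \<epsilon>) * \<tau>"
      using t R_nonneg \<open>0 \<le> \<epsilon>\<close> by (intro mult_left_mono) auto
    finally show ?thesis by (simp add: mult_ac)
  qed
  assume y: "y \<in> dual_optimal C V H" and near: "\<And>t. s \<le> t \<Longrightarrow> t \<le> s + \<tau> \<Longrightarrow> norm (q t - y) \<le> \<delta>"
  \<comment> \<open>A lower bound for \<open>v t \<bullet> (p - y)\<close> on the window, from
    \<open>lower\<close> and \<open>near\<close>, towards which \<open>x t \<bullet> (p - y)\<close>
    relaxes.\<close>
  define k where "k = p \<bullet> vs - 2 * R * \<epsilon> - \<delta> * R"
  have \<delta>: "0 \<le> \<delta>" using near[of s] \<open>0 \<le> \<tau>\<close> norm_ge_zero[of "q s - y"] by linarith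
  have np: "norm p \<le> G" unfolding p_def by (rule norm_gradH[OF vs_X])
  have "exp (s - (s + \<tau>)) * (x s \<bullet> (p - y) - k) \<le> x (s + \<tau>) \<bullet> (p - y) - k"
  proof (rule exp_comparison[OF lipschitz_on_inner_const[OF lipschitz_x[OF s]] _ negligible_E])
    fix t assume t: "t \<in> {s..s + \<tau>} - E"
    then have t0: "t \<in> {0..} - E" "s \<le> t" "t \<le> s + \<tau>" "t \<notin> E" using s by auto
    have "((\<lambda>t. x t \<bullet> (p - y)) has_real_derivative (v t - x t) \<bullet> (p - y)) (at t within {s..s + \<tau>})"
      by (intro has_real_derivative_inner_left subinterval_deriv[OF s] deriv_x t0)
    moreover have "k - x t \<bullet> (p - y) \<le> (v t - x t) \<bullet> (p - y)"
    proof -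
      have "\<bar>(q t - y) \<bullet> v t\<bar> \<le> \<delta> * R" using abs_inner_le[OF near norm_V[OF v_V]] t0 by blast
      moreover have "v t \<bullet> (p - y) = (p - q t) \<bullet> v t + (q t - y) \<bullet> v t"
        by (simp add: inner_diff_left inner_diff_right inner_commute)
      ultimately show ?thesis using lower[OF t0(2-4)] unfolding k_def inner_diff_left[of "v t"] by linarith
    qed
    ultimately show "\<exists>d\<ge>k - x t \<bullet> (p - y). ((\<lambda>t. x t \<bullet> (p - y)) has_real_derivative d) (at t within {s..s + \<tau>})" by blast
  qed (use \<open>0 \<le> \<tau>\<close> in simp)
  moreover have "exp (- \<tau>) * - ((2 * G + norm y) * R) \<le> exp (- \<tau>) * (x s \<bullet> (p - y) - k)"
  proof (rule mult_left_mono)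
    have "\<bar>x s \<bullet> (p - y)\<bar> \<le> R * (G + norm y)"
      using np norm_triangle_ineq4[of p y] by (intro abs_inner_le norm_X x_X s) linarith
    moreover have "\<bar>p \<bullet> vs\<bar> \<le> G * R" using np by (intro abs_inner_le norm_V vs_V)
    moreover have "0 \<le> 2 * R * \<epsilon>" "0 \<le> \<delta> * R" using R_nonneg \<open>0 \<le> \<epsilon>\<close> \<delta> by auto
    moreover have "(2 * G + norm y) * R = R * (G + norm y) + G * R" by (simp add: algebra_simps)
    ultimately show "- ((2 * G + norm y) * R) \<le> x s \<bullet> (p - y) - k" unfolding k_def by linarith
  qed simp
  ultimately have "k - exp (- \<tau>) * ((2 * G + norm y) * R) \<le> x (s + \<tau>) \<bullet> (p - y)" by simp
  moreover have "x (s + \<tau>) \<bullet> (p - y) = p \<bullet> (x (s + \<tau>) - vs) + p \<bullet> vs - y \<bullet> x (s + \<tau>)"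
    unfolding inner_commute[of "x (s + \<tau>)"] by (simp add: inner_diff_left inner_diff_right)
  moreover have "(2 * R + 1) * \<epsilon> = 2 * R * \<epsilon> + \<epsilon>" by (simp add: algebra_simps)
  ultimately show "H vs - ((2 * R + 1) * \<epsilon> + \<delta> * R + exp (- \<tau>) * ((2 * G + norm y) * R)) \<le> H (x (s + \<tau>)) - y \<bullet> x (s + \<tau>)"
    using lin[of "s + \<tau>", folded p_def] \<open>0 \<le> \<tau>\<close> unfolding k_def by linarith
qed

end

section \<open>Finding a window and staying near equilibrium\<close>

context egpd_path
begin

text \<open>Otherwise each of \<open>N\<close> consecutive blocks of length
  \<open>2 * \<tau>\<close> has, in its first half, a time at which the expression exceeds
  \<open>\<eta>\<close> for some \<open>w\<close>. For the same \<open>w\<close> it stays above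
  \<open>\<eta> / 2\<close> for a further time \<open>h \<le> \<tau>\<close>, still inside the
  block, so \<open>\<Phi> qs\<close> rises by \<open>\<eta> / 2 * h\<close> in every block, in total
  beyond its upper bound.\<close>

lemma window_exists:
  assumes qs: "qs \<in> dual_optimal C V H" and "0 \<le> T0" and h: "0 < h" "h \<le> \<tau>"
    and modulus: "\<And>z z'. z \<in> X \<Longrightarrow> z' \<in> X \<Longrightarrow> norm (z - z') \<le> 2 * R * h \<Longrightarrow> norm (gradH z - gradH z') \<le> \<omega>"
    and small: "2 * (\<omega> * R) + R * h * R + (G + norm qs) * (2 * R * h) \<le> \<eta> / 2"
    and N: "H vs - \<Phi> qs 0 < real N * (\<eta> / 2 * h)"
  shows "\<exists>s\<ge>T0. s \<le> T0 + 2 * real N * \<tau> \<and> (\<forall>t\<in>{s..s + \<tau>}. \<forall>w\<in>V.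
    (gradH (x t) - q t) \<bullet> w - (gradH (x t) - qs) \<bullet> x t \<le> \<eta>)"
proof (rule ccontr)
  assume neg: "\<not> ?thesis"
  have step: "\<eta> / 2 * h \<le> \<Phi> qs (T0 + 2 * real (Suc k) * \<tau>) - \<Phi> qs (T0 + 2 * real k * \<tau>)" if "k < N" for k
  proof -
    let ?s = "T0 + 2 * real k * \<tau>"
    have "real k * \<tau> \<le> real N * \<tau>" "0 \<le> real k * \<tau>" using that h by (auto intro: mult_right_mono)
    then have s: "T0 \<le> ?s" "?s \<le> T0 + 2 * real N * \<tau>" by (simp_all add: mult.assoc)
    with neg obtain t w where t: "t \<in> {?s..?s + \<tau>}" and w: "w \<in> V"
      and big: "\<eta> < (gradH (x t) - q t) \<bullet> w - (gradH (x t) - qs) \<bullet> x t"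
      by (metis not_le)
    have s0: "0 \<le> ?s" using s(1) \<open>0 \<le> T0\<close> by linarith
    have t': "?s \<le> t" "t \<le> ?s + \<tau>" using t unfolding atLeastAtMost_iff by blast+
    have t0: "0 \<le> t" using s0 t'(1) by linarith
    have "\<eta> / 2 * ((t + h) - t) \<le> \<Phi> qs (t + h) - \<Phi> qs t"
    proof (rule \<Phi>_increment[OF qs t0 _ w])
      fix r assume r: "r \<in> {t..t + h}"
      then have r0: "0 \<le> r" using t0 by auto
      have x: "norm (x r - x t) \<le> 2 * R * h"
        using lipschitz_onD[OF lipschitz_x[OF t0, of "t + h"], of r t] r h R_nonneg
          mult_left_mono[of "dist r t" h "2 * R"] by (auto simp: dist_norm)
      have q: "norm (q r - q t) \<le> R * h"
        using lipschitz_onD[OF lipschitz_q[OF t0, of "t + h"], of r t] r h R_nonneg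
          mult_left_mono[of "dist r t" h R] by (auto simp: dist_norm)
      have g: "norm (gradH (x r) - gradH (x t)) \<le> \<omega>" using modulus[OF x_X[OF r0] x_X[OF t0] x] .
      have "norm (gradH (x t) - qs) \<le> G + norm qs"
        using norm_gradH[OF x_X[OF t0]] norm_triangle_ineq4[of "gradH (x t)" qs] by linarith
      from abs_inner_le[OF this x] have
        "\<bar>(gradH (x t) - qs) \<bullet> (x r - x t)\<bar> \<le> (G + norm qs) * (2 * R * h)" .
      moreover have "\<bar>(gradH (x r) - gradH (x t)) \<bullet> w\<bar> \<le> \<omega> * R" by (rule abs_inner_le[OF g norm_V[OF w]])
      moreover have "\<bar>(gradH (x r) - gradH (x t)) \<bullet> x r\<bar> \<le> \<omega> * R" by (rule abs_inner_le[OF g norm_X[OF x_X[OF r0]]])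
      moreover have "\<bar>(q r - q t) \<bullet> w\<bar> \<le> R * h * R" by (rule abs_inner_le[OF q norm_V[OF w]])
      moreover have "(gradH (x r) - q r) \<bullet> w - (gradH (x r) - qs) \<bullet> x r =
          (gradH (x t) - q t) \<bullet> w - (gradH (x t) - qs) \<bullet> x t + (gradH (x r) - gradH (x t)) \<bullet> w
          - (q r - q t) \<bullet> w - (gradH (x r) - gradH (x t)) \<bullet> x r - (gradH (x t) - qs) \<bullet> (x r - x t)"
        by (simp add: inner_diff_left inner_diff_right)
      ultimately show "\<eta> / 2 \<le> (gradH (x r) - q r) \<bullet> w - (gradH (x r) - qs) \<bullet> x r"
        using big small by linarith
    qed (use h in simp)
    moreover have "\<Phi> qs ?s \<le> \<Phi> qs t" using s0 t'(1) by (rule \<Phi>_mono[OF qs])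
    moreover have "\<Phi> qs (t + h) \<le> \<Phi> qs (T0 + 2 * real (Suc k) * \<tau>)"
    proof (rule \<Phi>_mono[OF qs])
      have "?s + 2 * \<tau> = T0 + 2 * real (Suc k) * \<tau>" by (simp add: algebra_simps)
      then show "t + h \<le> T0 + 2 * real (Suc k) * \<tau>" using t'(2) h(2) by linarith
    qed (use t0 h in simp)
    ultimately show ?thesis by simp
  qed
  have "real k * (\<eta> / 2 * h) \<le> \<Phi> qs (T0 + 2 * real k * \<tau>) - \<Phi> qs T0" if "k \<le> N" for k
    using that
  proof (induction k)
    case (Suc k)
    then have "real k * (\<eta> / 2 * h) \<le> \<Phi> qs (T0 + 2 * real k * \<tau>) - \<Phi> qs T0" by simp
    moreover have "real (Suc k) * (\<eta> / 2 * h) = real k * (\<eta> / 2 * h) + \<eta> / 2 * h" by (simp add: algebra_simps)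
    ultimately show ?case using step[of k] Suc.prems by linarith
  qed simp
  from this[of N] have "real N * (\<eta> / 2 * h) \<le> \<Phi> qs (T0 + 2 * real N * \<tau>) - \<Phi> qs T0" by simp
  moreover have "\<Phi> qs (T0 + 2 * real N * \<tau>) \<le> H vs"
  proof -
    have "0 \<le> T0 + 2 * real N * \<tau>" using \<open>0 \<le> T0\<close> h by simp
    from \<Phi>_upper[OF qs this] show ?thesis
      using zero_le_power2[of "norm (q (T0 + 2 * real N * \<tau>) - qs)"] by linarith
  qed
  moreover have "\<Phi> qs 0 \<le> \<Phi> qs T0" using \<Phi>_mono[OF qs _ \<open>0 \<le> T0\<close>] by simp
  ultimately show False using N by linarith
qed

text \<open>The deficit of \<open>\<Phi> y\<close> at \<open>s\<close> has three parts, from the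
  Lagrangian, the distance of \<open>q\<close> and the exponential term, each at most
  \<open>\<theta>\<^sup>2 / 6\<close>. A deficit of \<open>\<theta>\<^sup>2 / 2\<close> keeps
  \<open>q\<close> within \<open>\<theta>\<close> of \<open>y\<close> ever after.\<close>

lemma remain_near_optimal:
  assumes y: "y \<in> dual_optimal C V H" and s: "0 \<le> s" and \<theta>: "0 < \<theta>" "\<theta> \<le> 1"
    and q: "norm (q s - y) \<le> \<theta>\<^sup>2 / 6" and x: "H vs - \<theta>\<^sup>2 / 6 \<le> H (x s) - y \<bullet> x s"
    and decay: "2 * R * (G + norm y) * exp (- s) \<le> \<theta>\<^sup>2 / 6" and t: "s \<le> t"
  shows "norm (q t - y) \<le> \<theta>" and "H vs - \<theta> \<le> H (x t) - y \<bullet> x t"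
proof -
  have sq: "\<theta>\<^sup>2 \<le> \<theta>" using \<theta> by (simp add: power2_eq_square mult_left_le)
  \<comment> \<open>The distance is at most \<open>1\<close>, so its square does not exceed
    it.\<close>
  have "(norm (q s - y))\<^sup>2 \<le> norm (q s - y)"
    unfolding power2_eq_square by (rule mult_left_le) (use q sq \<theta> in auto)
  then have "(q s - y) \<bullet> (q s - y) / 2 \<le> \<theta>\<^sup>2 / 6"
    using q zero_le_power2[of "norm (q s - y)"] unfolding dot_square_norm by linarith
  then have \<Phi>: "H vs - \<theta>\<^sup>2 / 2 \<le> \<Phi> y s" using x decay by (simp add: \<Phi>_def)
  then have "(norm (q t - y))\<^sup>2 \<le> \<theta>\<^sup>2" using q_stays_near[OF y s t] by simp
  then show "norm (q t - y) \<le> \<theta>" using \<theta> by (simp add: power2_le_iff_abs_le)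
  show "H vs - \<theta> \<le> H (x t) - y \<bullet> x t" using lagrangian_stays_large[OF y s t] \<Phi> sq \<theta> by linarith
qed

text \<open>The hypothesis \<open>decay\<close> says that \<open>x\<close> has had time since
  \<open>s\<close> to forget its state there; the bounds of \<open>coordinate_comparison\<close>
  then become \<open>2 * \<theta> + \<theta>\<close>.\<close>

lemma x_nearly_optimal:
  assumes y: "y \<in> dual_optimal C V H" "norm y \<le> Y" and s: "0 \<le> s" "s \<le> t"
    and near: "\<And>r. s \<le> r \<Longrightarrow> r \<le> t \<Longrightarrow> norm (q r - y) \<le> \<theta>"
    and L: "H vs - \<theta> \<le> H (x t) - y \<bullet> x t" and decay: "exp (s - t) * R \<le> \<theta>"
  shows "x t $ n \<le> 3 * \<theta>" and "n \<notin> C \<Longrightarrow> \<bar>x t $ n\<bar> \<le> 3 * \<theta>"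
    and "H vs - (1 + real CARD('a) * (3 * Y + R)) * \<theta> \<le> H (x t)"
proof -
  show up: "x t $ n \<le> 3 * \<theta>" using coordinate_comparison(1)[OF s near, of n] decay by simp
  show "\<bar>x t $ n\<bar> \<le> 3 * \<theta>" if "n \<notin> C"
    using coordinate_comparison(2)[OF s near, of n] up decay q'_eq[of n] that by (simp add: abs_le_iff)
  have \<theta>: "0 \<le> \<theta>" using near[of s] s norm_ge_zero[of "q s - y"] by linarith
  have yf: "y \<in> dual_feasible C" using y dual_optimal_iff[OF vs_optimal] by blast
  have "norm y * (2 * \<theta> + exp (s - t) * R) + \<theta> * R \<le> Y * (3 * \<theta>) + \<theta> * R"
    using y(2) decay \<theta> R_nonneg norm_ge_zero[of y]
      order_trans[OF norm_ge_zero y(2)]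
    by (intro add_mono order_refl mult_mono) auto
  then have "real CARD('a) * (norm y * (2 * \<theta> + exp (s - t) * R) + \<theta> * R) \<le> real CARD('a) * (Y * (3 * \<theta>) + \<theta> * R)"
    by (intro mult_left_mono) auto
  moreover have "- (real CARD('a) * (norm y * (2 * \<theta> + exp (s - t) * R) + \<theta> * R)) \<le> y \<bullet> x t"
    using inner_lower[OF yf s near] .
  moreover have "(1 + real CARD('a) * (3 * Y + R)) * \<theta> = \<theta> + real CARD('a) * (Y * (3 * \<theta>) + \<theta> * R)"
    by (simp add: algebra_simps)
  ultimately show "H vs - (1 + real CARD('a) * (3 * Y + R)) * \<theta> \<le> H (x t)" using L by linarith
qed

end

lemma exp_decay_eventually: "\<epsilon> > 0 \<Longrightarrow> eventually (\<lambda>t. c * exp (- t) < \<epsilon>) at_top" for c \<epsilon> :: real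
proof -
  assume "\<epsilon> > 0"
  have "((\<lambda>t. c * exp (- t)) \<longlongrightarrow> c * 0) at_top"
    by (intro tendsto_intros filterlim_compose[OF exp_at_bot filterlim_uminus_at_bot_at_top])
  then show ?thesis using \<open>\<epsilon> > 0\<close> by (auto dest: order_tendstoD(2))
qed

lemma exp_decayE:
  fixes c \<epsilon> :: real
  assumes "\<epsilon> > 0"
  obtains T where "T > 0" "\<And>t. T \<le> t \<Longrightarrow> c * exp (- t) < \<epsilon>"
proof -
  obtain T where "\<And>t. T \<le> t \<Longrightarrow> c * exp (- t) < \<epsilon>"
    using exp_decay_eventually[OF assms, of c] unfolding eventually_at_top_linorder by blast
  then show ?thesis using that[of "max T 1"] by auto
qed

section \<open>The common settling time\<close>

context egpd_region
begin

text \<open>Tolerances are chosen backwards from the goal: \<open>\<theta>\<close> for the final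
  confinement, \<open>\<delta>\<close> for the accuracy at the end of a window that secures it,
  \<open>\<epsilon>1\<close> and \<open>\<eta>\<close> for the accuracies on the window that produce
  \<open>\<delta>\<close>. The initial state enters only through \<open>X\<close> and
  \<open>B\<close>.\<close>

lemma uniform_settling:
  assumes "\<epsilon> > 0"
  shows "\<exists>T\<ge>0. \<forall>x q v E. egpd_path C V Vt H gradH X R G vs x q v E \<longrightarrow> norm (q 0) \<le> B \<longrightarrow>
    (\<exists>y\<in>dual_optimal C V H. \<forall>t\<ge>T. norm (q t - y) \<le> \<epsilon> \<and> infdist (x t) (primal_optimal C V H) \<le> \<epsilon>)"
proof -
  obtain qs where qs: "qs \<in> dual_optimal C V H" using dual_optimal_nonempty by blast
  \<comment> \<open>\<open>W\<close> bounds the initial deficit by \<open>\<Phi>_0_lower\<close>;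
    hence \<open>Q\<close> bounds \<open>q\<close> at all times, and \<open>Y\<close> bounds every
    dual optimum within distance \<open>1\<close> of \<open>q\<close>.\<close>
  define W where "W = 4 * R * G + 3 * R * norm qs + (\<bar>B\<bar> + norm qs)\<^sup>2 / 2"
  define Q where "Q = norm qs + sqrt (2 * W)"
  define Y where "Y = Q + 1"
  have "0 \<le> W" using R_nonneg G_nonneg by (simp add: W_def)
  have "0 \<le> Y" using \<open>0 \<le> W\<close> by (simp add: Y_def Q_def)
  define c where "c = 2 * R * (G + Y)"
  have c: "2 * R * (G + norm y) * exp (- t) \<le> c * exp (- t)" if "norm y \<le> Y" for y :: "real ^ 'a" and t
    unfolding c_def using R_nonneg that by (intro mult_right_mono mult_left_mono) auto
  obtain \<delta>p where \<delta>p: "\<delta>p > 0" "\<forall>z\<in>X. infdist z V < \<delta>p \<longrightarrow> (\<forall>n\<in>C. z $ n < \<delta>p) \<longrightarrow> (\<forall>n\<in>-C. \<bar>z $ n\<bar> < \<delta>p) \<longrightarrow>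
    H vs - \<delta>p < H z \<longrightarrow> infdist z (primal_optimal C V H) < \<epsilon>"
    using near_primal_optimal[OF assms] by blast
  define K where "K = 1 + real CARD('a) * (3 * Y + R)"
  have "K \<ge> 1" using R_nonneg \<open>0 \<le> Y\<close> by (simp add: K_def)
  define \<theta> where "\<theta> = min (min 1 \<epsilon>) (\<delta>p / (4 * K))"
  have \<theta>: "0 < \<theta>" "\<theta> \<le> 1" "\<theta> \<le> \<epsilon>" using \<open>K \<ge> 1\<close> \<delta>p(1) assms by (auto simp: \<theta>_def)
  have "\<theta> \<le> \<delta>p / (4 * K)" by (simp add: \<theta>_def)
  then have "4 * (K * \<theta>) \<le> \<delta>p" using \<open>K \<ge> 1\<close> by (simp add: field_simps)
  moreover have "1 * \<theta> \<le> K * \<theta>" using \<open>K \<ge> 1\<close> \<theta>(1) by (intro mult_right_mono) auto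
  ultimately have K\<theta>: "3 * \<theta> < \<delta>p" "K * \<theta> < \<delta>p" using \<theta>(1) by linarith+
  define \<delta> where "\<delta> = \<theta>\<^sup>2 / 6"
  have \<delta>: "\<delta> > 0" using \<theta>(1) by (simp add: \<delta>_def)
  have "\<delta> \<le> 1" using \<theta> power_le_one[of \<theta> 2] by (simp add: \<delta>_def)
  \<comment> \<open>The error in the Lagrangian at the end of a window has three sources:
    \<open>\<epsilon>1\<close>, the distance from \<open>q\<close> to \<open>y\<close>, and the
    memory of the initial \<open>x\<close>. Each is given \<open>\<delta> / 3\<close>;
    \<open>\<tau>\<close> takes care of the last.\<close>
  define \<delta>2 where "\<delta>2 = \<delta> / (3 * (R + 1))"
  have \<delta>2: "0 < \<delta>2" "\<delta>2 \<le> \<delta>" "\<delta>2 * R \<le> \<delta> / 3"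
    using \<delta> R_nonneg by (auto simp: \<delta>2_def field_simps)
  obtain \<tau> where \<tau>: "\<tau> > 0" "(2 * G + Y) * R * exp (- \<tau>) < \<delta> / 3"
    using exp_decayE[of "\<delta> / 3" "(2 * G + Y) * R"] \<delta> by (metis divide_pos_pos order_refl zero_less_numeral)
  obtain \<delta>d where \<delta>d: "\<delta>d > 0" "\<forall>y\<in>dual_feasible C. norm y \<le> Q \<longrightarrow> (\<forall>w\<in>V. H w - y \<bullet> w \<le> H vs + \<delta>d) \<longrightarrow>
    (\<exists>z\<in>dual_optimal C V H. norm (y - z) \<le> \<delta>2 / 2)"
    using near_dual_optimal[of "\<delta>2 / 2" Q] \<delta>2(1) by auto
  \<comment> \<open>One entry for each conclusion of \<open>near_optimal_window\<close>, in the
    order third, first, second. The drift of \<open>q\<close> grows with \<open>\<tau>\<close>, so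
    the length had to be fixed before.\<close>
  define \<epsilon>1 where "\<epsilon>1 = min (min (\<delta> / (3 * (2 * R + 1))) (\<delta>d / (2 * R + 3))) ((\<delta>2 / 2)\<^sup>2 / (2 * (4 * R + 3) * \<tau>))"
  have \<epsilon>1: "\<epsilon>1 > 0" using \<delta> \<delta>d(1) \<delta>2(1) \<tau>(1) R_nonneg by (auto simp: \<epsilon>1_def intro!: divide_pos_pos mult_pos_pos add_nonneg_pos)
  have "\<epsilon>1 \<le> \<delta> / (3 * (2 * R + 1))" "\<epsilon>1 \<le> \<delta>d / (2 * R + 3)" "\<epsilon>1 \<le> (\<delta>2 / 2)\<^sup>2 / (2 * (4 * R + 3) * \<tau>)"
    by (auto simp: \<epsilon>1_def)
  then have \<epsilon>1_le: "(2 * R + 1) * \<epsilon>1 \<le> \<delta> / 3" "(2 * R + 3) * \<epsilon>1 \<le> \<delta>d" "2 * (4 * R + 3) * \<epsilon>1 * \<tau> \<le> (\<delta>2 / 2)\<^sup>2"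
    using R_nonneg \<tau>(1) by (simp_all add: pos_le_divide_eq mult_ac add_nonneg_pos)
  obtain \<delta>g where \<delta>g: "\<delta>g > 0" "\<forall>z\<in>X. infdist z V < \<delta>g \<longrightarrow> H vs - \<delta>g < H z - qs \<bullet> z \<longrightarrow>
    norm (gradH z - gradH vs) \<le> \<epsilon>1 \<and> \<bar>H z - H vs - gradH vs \<bullet> (z - vs)\<bar> \<le> \<epsilon>1"
    using near_lagrangian_maximizer[OF qs \<epsilon>1] by blast
  define \<eta> where "\<eta> = min \<epsilon>1 (\<delta>g / 2)"
  have \<eta>: "0 < \<eta>" "\<eta> \<le> \<epsilon>1" "\<eta> < \<delta>g" using \<epsilon>1 \<delta>g(1) by (auto simp: \<eta>_def)
  define \<omega> where "\<omega> = \<eta> / (8 * (R + 1))"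
  have \<omega>: "\<omega> > 0" "2 * (\<omega> * R) \<le> \<eta> / 4" using \<eta>(1) R_nonneg by (auto simp: \<omega>_def field_simps)
  have "uniformly_continuous_on X gradH"
    by (intro compact_uniformly_continuous continuous_on_subset[OF cont_gradH X_Vt] compact_X)
  then obtain d where d: "d > 0" "\<And>z z'. z \<in> X \<Longrightarrow> z' \<in> X \<Longrightarrow> norm (z - z') < d \<Longrightarrow> norm (gradH z - gradH z') < \<omega>"
    using \<omega>(1) unfolding uniformly_continuous_on_def dist_norm by metis
  \<comment> \<open>\<open>M * h\<close> covers the variation over a time \<open>h\<close> in
    \<open>window_exists\<close> apart from that of the gradient; the summand
    \<open>2 * R + 1\<close> ensures \<open>2 * R * h < d\<close>, so that uniform continuity
    applies.\<close>
  define M where "M = R * R + (G + norm qs) * (2 * R) + 2 * R + 1"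
  have M: "M > 0" "2 * R < M" using R_nonneg G_nonneg by (auto simp: M_def add_nonneg_pos)
  define h where "h = min \<tau> (min (d / M) (\<eta> / (4 * M)))"
  have h: "0 < h" "h \<le> \<tau>" "h \<le> d / M" "h \<le> \<eta> / (4 * M)" using \<tau>(1) d(1) \<eta>(1) M(1) by (auto simp: h_def)
  have hM: "M * h \<le> d" "M * h \<le> \<eta> / 4" using h(3,4) M(1) by (auto simp: field_simps)
  have "2 * R * h < M * h" using M(2) h(1) by simp
  have modulus: "norm (gradH z - gradH z') \<le> \<omega>" if "z \<in> X" "z' \<in> X" "norm (z - z') \<le> 2 * R * h" for z z'
    using d(2)[OF that(1,2)] that(3) \<open>2 * R * h < M * h\<close> hM(1) by simp
  have "R * h * R + (G + norm qs) * (2 * R * h) + (2 * R * h + h) = M * h" by (simp add: M_def algebra_simps)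
  moreover have "0 \<le> 2 * R * h + h" using R_nonneg h(1) by simp
  ultimately have small: "2 * (\<omega> * R) + R * h * R + (G + norm qs) * (2 * R * h) \<le> \<eta> / 2"
    using \<omega>(2) hM(2) by linarith
  obtain N where N: "W < real N * (\<eta> / 2 * h)"
    using reals_Archimedean3[of "\<eta> / 2 * h"] \<eta>(1) h(1) by fastforce
  define m where "m = min (min \<delta>g \<epsilon>1) (min \<delta> \<delta>p)"
  have "m > 0" using \<delta>g(1) \<epsilon>1 \<delta> \<delta>p(1) by (simp add: m_def)
  obtain T2 where T2: "T2 > 0" "\<And>t. T2 \<le> t \<Longrightarrow> c * exp (- t) < m" by (rule exp_decayE[OF \<open>m > 0\<close>, of c]) (rule that)
  obtain T3 where T3: "T3 > 0" "\<And>t. T3 \<le> t \<Longrightarrow> (2 * R) * exp (- t) < m" by (rule exp_decayE[OF \<open>m > 0\<close>, of "2 * R"]) (rule that)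
  define T0 where "T0 = max T2 T3"
  have T0: "T0 > 0" "\<And>t. T0 \<le> t \<Longrightarrow> c * exp (- t) < m" "\<And>t. T0 \<le> t \<Longrightarrow> 2 * R * exp (- t) < m"
    using T2 T3 by (auto simp: T0_def)
  \<comment> \<open>Waiting time after the window, for the hypothesis \<open>decay\<close> of
    \<open>x_nearly_optimal\<close>.\<close>
  obtain T1 where T1: "T1 > 0" "\<And>t. T1 \<le> t \<Longrightarrow> R * exp (- t) < \<theta>" by (rule exp_decayE[OF \<theta>(1), of R]) (rule that)
  have m: "m \<le> \<delta>g" "m \<le> \<epsilon>1" "m \<le> \<delta>" "m \<le> \<delta>p" by (auto simp: m_def)
  show ?thesis
  proof (intro exI[of _ "T0 + 2 * real N * \<tau> + \<tau> + T1"] conjI allI impI)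
    show "0 \<le> T0 + 2 * real N * \<tau> + \<tau> + T1" using T0(1) T1(1) \<tau>(1) by simp
    fix x q v E
    assume path: "egpd_path C V Vt H gradH X R G vs x q v E" and B: "norm (q 0) \<le> B"
    interpret egpd_path C V Vt H gradH X R G vs x q v E by (rule path)
    have "norm (q 0 - qs) \<le> \<bar>B\<bar> + norm qs" using norm_triangle_ineq4[of "q 0" qs] B by linarith
    then have W: "H vs - \<Phi> qs 0 \<le> W" using \<Phi>_0_lower[of qs "\<bar>B\<bar> + norm qs"] by (simp add: W_def)
    have Q: "norm (q t) \<le> Q" if "0 \<le> t" for t
    proof -
      have "(norm (q t - qs))\<^sup>2 \<le> 2 * W" using q_stays_near[OF qs order_refl that] W by simp
      then have "norm (q t - qs) \<le> sqrt (2 * W)" by (rule real_le_rsqrt)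
      then show ?thesis using norm_triangle_sub[of "q t" qs] by (simp add: Q_def)
    qed
    have "H vs - \<Phi> qs 0 < real N * (\<eta> / 2 * h)" using W N by simp
    from window_exists[OF qs less_imp_le[OF T0(1)] h(1,2) modulus small this]
    obtain s where s: "T0 \<le> s" "s \<le> T0 + 2 * real N * \<tau>" and window: "\<And>t w. t \<in> {s..s + \<tau>} \<Longrightarrow> w \<in> V \<Longrightarrow>
        (gradH (x t) - q t) \<bullet> w - (gradH (x t) - qs) \<bullet> x t \<le> \<eta>"
      by blast
    have s0: "0 \<le> s" using s T0(1) by simp
    have close: "norm (gradH (x t) - gradH vs) \<le> \<epsilon>1 \<and> \<bar>H (x t) - H vs - gradH vs \<bullet> (x t - vs)\<bar> \<le> \<epsilon>1"
      if t: "s \<le> t" "t \<le> s + \<tau>" for t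
    proof -
      have t0: "0 \<le> t" using t s0 by simp
      have "infdist (x t) V < \<delta>g" using infdist_x_V[OF t0] T0(3)[of t] s t m(1) by simp
      \<comment> \<open>The window bound at \<open>w = vs\<close>, with concavity, makes
        \<open>x t\<close> a near maximizer of the Lagrangian of \<open>qs\<close>.\<close>
      moreover have "H vs - \<delta>g < H (x t) - qs \<bullet> x t"
      proof -
        have "H vs \<le> H (x t) + gradH (x t) \<bullet> (vs - x t)"
          using x_X[OF t0] vs_X X_Vt by (intro supergradient) auto
        moreover have "q t \<bullet> vs \<le> 0" using inner_vs_le_0 q_feasible[OF t0] .
        moreover have "(gradH (x t) - q t) \<bullet> vs - (gradH (x t) - qs) \<bullet> x t \<le> \<eta>" using window[OF _ vs_V] t by simp
        ultimately show ?thesis using \<eta>(3) by (simp add: inner_diff_left inner_diff_right)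
      qed
      ultimately show ?thesis using \<delta>g(2) x_X[OF t0] by blast
    qed
    have "norm qs \<le> Y" using \<open>0 \<le> W\<close> by (simp add: Y_def Q_def)
    then have decay: "2 * R * (G + norm qs) * exp (- s) \<le> \<epsilon>1" using c[of qs s] T0(2)[OF s(1)] m(2) by linarith
    have window': "(gradH (x t) - q t) \<bullet> w - (gradH (x t) - qs) \<bullet> x t \<le> \<epsilon>1"
      if "s \<le> t" "t \<le> s + \<tau>" "w \<in> V" for t w using window[of t w] that \<eta>(2) by simp
    note near = near_optimal_window[OF qs s0 less_imp_le[OF \<tau>(1)] less_imp_le[OF \<epsilon>1] _ _ _ decay]
    have "H w - q s \<bullet> w \<le> H vs + (2 * R + 3) * \<epsilon>1" if "w \<in> V" for w
      by (rule near(1)) (use close window' that in auto)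
    then have "H w - q s \<bullet> w \<le> H vs + \<delta>d" if "w \<in> V" for w using \<epsilon>1_le(2) that by force
    \<comment> \<open>From here on \<open>y\<close>, close to \<open>q s\<close>, replaces
      \<open>qs\<close>, which served to find the window.\<close>
    then obtain y where y: "y \<in> dual_optimal C V H" "norm (q s - y) \<le> \<delta>2 / 2"
      using \<delta>d(2) q_feasible[OF s0] Q[OF s0] by blast
    have Y: "norm y \<le> Y"
      using y(2) \<delta>2(2) \<open>\<delta> \<le> 1\<close> Q[OF s0] norm_triangle_sub[of y "q s"] by (simp add: Y_def norm_minus_commute)
    have q_near: "norm (q t - y) \<le> \<delta>2" if t: "s \<le> t" "t \<le> s + \<tau>" for t
    proof -
      have "(norm (q t - q s))\<^sup>2 \<le> 2 * (4 * R + 3) * \<epsilon>1 * \<tau>"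
        by (rule near(2)) (use close window' t in auto)
      then have "(norm (q t - q s))\<^sup>2 \<le> (\<delta>2 / 2)\<^sup>2" using \<epsilon>1_le(3) by linarith
      then have "norm (q t - q s) \<le> \<delta>2 / 2" using \<delta>2(1) by (simp add: power2_le_iff_abs_le)
      then show ?thesis using y(2) norm_triangle_ineq[of "q t - q s" "q s - y"] by simp
    qed
    define s' where "s' = s + \<tau>"
    have s': "0 \<le> s'" "T0 \<le> s'" using s0 s \<tau>(1) by (auto simp: s'_def)
    have q_s': "norm (q s' - y) \<le> \<theta>\<^sup>2 / 6" using q_near[of s'] \<tau>(1) \<delta>2(2) by (simp add: s'_def \<delta>_def)
    have x_s': "H vs - \<theta>\<^sup>2 / 6 \<le> H (x s') - y \<bullet> x s'"
    proof -
      have "exp (- \<tau>) * ((2 * G + norm y) * R) \<le> exp (- \<tau>) * ((2 * G + Y) * R)"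
        using Y R_nonneg by (intro mult_left_mono mult_right_mono) auto
      moreover have "exp (- \<tau>) * ((2 * G + Y) * R) < \<delta> / 3" using \<tau>(2) by (simp add: mult.commute)
      moreover have "H vs - ((2 * R + 1) * \<epsilon>1 + \<delta>2 * R + exp (- \<tau>) * ((2 * G + norm y) * R)) \<le> H (x s') - y \<bullet> x s'"
        unfolding s'_def by (rule near(3)[OF _ _ _ y(1)]) (use close window' q_near in auto)
      ultimately show ?thesis using \<epsilon>1_le(1) \<delta>2(3) unfolding \<delta>_def[symmetric] by linarith
    qed
    have decay': "2 * R * (G + norm y) * exp (- s') \<le> \<theta>\<^sup>2 / 6"
      using c[OF Y, of s'] T0(2)[OF s'(2)] m(3) unfolding \<delta>_def by linarith
    note remain = remain_near_optimal[OF y(1) s'(1) \<theta>(1,2) q_s' x_s' decay']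
    show "\<exists>y\<in>dual_optimal C V H. \<forall>t\<ge>T0 + 2 * real N * \<tau> + \<tau> + T1.
        norm (q t - y) \<le> \<epsilon> \<and> infdist (x t) (primal_optimal C V H) \<le> \<epsilon>"
    proof (intro bexI[OF _ y(1)] allI impI conjI)
      fix t assume "T0 + 2 * real N * \<tau> + \<tau> + T1 \<le> t"
      then have t: "s' \<le> t" "T1 \<le> t - s'" "0 \<le> t" "T0 \<le> t" using s s' T1(1) by (auto simp: s'_def)
      show "norm (q t - y) \<le> \<epsilon>" using remain(1)[OF t(1)] \<theta>(3) by simp
      have "exp (s' - t) * R \<le> \<theta>" using T1(2)[OF t(2)] by (simp add: mult.commute)
      note nearly = x_nearly_optimal[OF y(1) Y s'(1) t(1) _ remain(2)[OF t(1)] this]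
      have x1: "x t $ n < \<delta>p" for n
        using nearly(1)[of n, OF remain(1)] K\<theta>(1) by simp
      have x2: "\<bar>x t $ n\<bar> < \<delta>p" if "n \<notin> C" for n
        using nearly(2)[of n, OF remain(1)] that K\<theta>(1) by simp
      have x3: "H vs - \<delta>p < H (x t)"
        using nearly(3)[OF remain(1)] K\<theta>(2) by (simp add: K_def)
      have "infdist (x t) V < \<delta>p" using infdist_x_V[OF t(3)] T0(3)[OF t(4)] m(4) by simp
      then have "infdist (x t) (primal_optimal C V H) < \<epsilon>" using \<delta>p(2) x_X[OF t(3)] x1 x2 x3 by simp
      then show "infdist (x t) (primal_optimal C V H) \<le> \<epsilon>" by simp
    qed
  qed
qed

end

section \<open>Convergence\<close>

lemma (in egpd_region) trajectory_imp_path: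
  assumes traj: "egpd_trajectory C V Vt gradH x q" and "x 0 \<in> X"
  obtains v E where "egpd_path C V Vt H gradH X R G vs x q v E"
proof -
  obtain v where "AE t in lebesgue_on {0..}.
          is_arg_max (\<lambda>w. (gradH (x t) - q t) \<bullet> w) (\<lambda>w. w \<in> V) (v t)
        \<and> (x has_vector_derivative (v t - x t)) (at t within {0..})
        \<and> (\<forall>n\<in>C. ((\<lambda>s. q s $ n) has_real_derivative pos_part_at (q t $ n) (v t $ n)) (at t within {0..}))
        \<and> (\<forall>n\<in>-C. ((\<lambda>s. q s $ n) has_real_derivative v t $ n) (at t within {0..}))"
    using traj unfolding egpd_trajectory_def by blast
  then obtain E where "negligible E" and E: "\<And>t. t \<in> {0..} - E \<Longrightarrow>
          is_arg_max (\<lambda>w. (gradH (x t) - q t) \<bullet> w) (\<lambda>w. w \<in> V) (v t)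
        \<and> (x has_vector_derivative (v t - x t)) (at t within {0..})
        \<and> (\<forall>n\<in>C. ((\<lambda>s. q s $ n) has_real_derivative pos_part_at (q t $ n) (v t $ n)) (at t within {0..}))
        \<and> (\<forall>n\<in>-C. ((\<lambda>s. q s $ n) has_real_derivative v t $ n) (at t within {0..}))"
    by (rule AE_lebesgue_on_imp_negligible) auto
  have "egpd_path C V Vt H gradH X R G vs x q v E"
  proof
    show "abs_continuous_on {0..T} x" "abs_continuous_on {0..T} q" if "0 \<le> T" for T
      using traj that by (auto simp: egpd_trajectory_def)
    show "q t \<in> dual_feasible C" if "0 \<le> t" for t
      using traj that by (auto simp: egpd_trajectory_def dual_feasible_def)
  qed (use E \<open>negligible E\<close> \<open>x 0 \<in> X\<close> in \<open>auto simp: is_arg_max_linorder\<close>)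
  then show ?thesis by (rule that)
qed

context egpd_problem
begin

text \<open>The convex hull of \<open>V\<close> and the initial states is compact in finite
  dimension and stays inside the convex \<open>Vt\<close>.\<close>

lemma region_exists:
  assumes "compact VB" "VB \<subseteq> Vt"
  obtains X R G vs where "egpd_region C V Vt H gradH X R G vs" "VB \<subseteq> X"
proof -
  define X where "X = convex hull (V \<union> VB)"
  have "X \<subseteq> Vt" unfolding X_def using V_subset assms(2) convex_Vt by (intro hull_minimal) auto
  then have X: "compact X" "convex X" "V \<subseteq> X" "VB \<subseteq> X" "X \<subseteq> Vt"
    using compact_V assms(1) hull_subset[of "V \<union> VB" convex]
    unfolding X_def by (auto intro!: compact_convex_hull compact_Un)
  obtain R where R: "\<forall>z\<in>X. norm z \<le> R" using compact_imp_bounded[OF X(1)] unfolding bounded_iff by blast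
  have "bounded (gradH ` X)"
    using X(1,5) by (intro compact_imp_bounded compact_continuous_image continuous_on_subset[OF cont_gradH])
  then obtain G where G: "\<forall>z\<in>X. norm (gradH z) \<le> G" unfolding bounded_iff by blast
  obtain vs where vs: "vs \<in> primal_optimal C V H" using primal_optimal_nonempty by blast
  have "egpd_region C V Vt H gradH X R G vs" using X R G vs by unfold_locales auto
  then show ?thesis using that X(4) by blast
qed

lemma uniform_settling_trajectories:
  assumes "compact VB" "VB \<subseteq> Vt" "bounded QB" "\<epsilon> > 0"
  obtains T where "0 \<le> T" and "\<And>x q. egpd_trajectory C V Vt gradH x q \<Longrightarrow> x 0 \<in> VB \<Longrightarrow> q 0 \<in> QB \<Longrightarrow>
    \<exists>y\<in>dual_optimal C V H. \<forall>t\<ge>T. norm (q t - y) \<le> \<epsilon> \<and> infdist (x t) (primal_optimal C V H) \<le> \<epsilon>"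
proof -
  obtain X R G vs where "egpd_region C V Vt H gradH X R G vs" and X: "VB \<subseteq> X"
    using region_exists[OF assms(1,2)] .
  then interpret egpd_region C V Vt H gradH X R G vs by simp
  obtain B where B: "\<forall>y\<in>QB. norm y \<le> B" using \<open>bounded QB\<close> unfolding bounded_iff by blast
  obtain T where T: "0 \<le> T" "\<And>x q v E. egpd_path C V Vt H gradH X R G vs x q v E \<Longrightarrow> norm (q 0) \<le> B \<Longrightarrow>
      \<exists>y\<in>dual_optimal C V H. \<forall>t\<ge>T. norm (q t - y) \<le> \<epsilon> \<and> infdist (x t) (primal_optimal C V H) \<le> \<epsilon>"
    using uniform_settling[OF \<open>\<epsilon> > 0\<close>, of B] by blast
  show ?thesis
  proof (rule that[OF T(1)])
    fix x q assume 1: "egpd_trajectory C V Vt gradH x q" "x 0 \<in> VB" "q 0 \<in> QB"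
    obtain v E where "egpd_path C V Vt H gradH X R G vs x q v E"
      using trajectory_imp_path[OF 1(1)] 1(2) X by blast
    from T(2)[OF this] B 1(3)
    show "\<exists>y\<in>dual_optimal C V H. \<forall>t\<ge>T. norm (q t - y) \<le> \<epsilon> \<and> infdist (x t) (primal_optimal C V H) \<le> \<epsilon>"
      by blast
  qed
qed

text \<open>The uniform statement with singletons as sets of initial states.\<close>

lemma trajectory_settles:
  assumes "egpd_trajectory C V Vt gradH x q" "\<epsilon> > 0"
  obtains T y where "y \<in> dual_optimal C V H"
    "\<And>t. T \<le> t \<Longrightarrow> norm (q t - y) \<le> \<epsilon>" "\<And>t. T \<le> t \<Longrightarrow> infdist (x t) (primal_optimal C V H) \<le> \<epsilon>"
proof -
  have "x 0 \<in> Vt" using assms(1) by (simp add: egpd_trajectory_def)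
  then obtain T where "\<exists>y\<in>dual_optimal C V H. \<forall>t\<ge>T. norm (q t - y) \<le> \<epsilon> \<and> infdist (x t) (primal_optimal C V H) \<le> \<epsilon>"
    using uniform_settling_trajectories[of "{x 0}" "{q 0}" \<epsilon>] assms by (metis bounded_insert bounded_empty compact_sing
        empty_subsetI insert_subset singletonI)
  then show ?thesis using that by blast
qed

lemma primal_convergence:
  assumes "egpd_trajectory C V Vt gradH x q"
  shows "tends_to_set x (primal_optimal C V H)"
  unfolding tends_to_set_def
proof (intro conjI primal_optimal_nonempty tendstoI)
  fix e :: real assume "e > 0"
  then have "e / 2 > 0" by simp
  then obtain T where "\<And>t. T \<le> t \<Longrightarrow> infdist (x t) (primal_optimal C V H) \<le> e / 2"
    using trajectory_settles[OF assms] by metis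
  then have "dist (infdist (x t) (primal_optimal C V H)) 0 < e" if "T \<le> t" for t
    using that \<open>e > 0\<close> by (force simp: infdist_nonneg)
  then show "\<forall>\<^sub>F t in at_top. dist (infdist (x t) (primal_optimal C V H)) 0 < e"
    unfolding eventually_at_top_linorder by blast
qed

text \<open>The dual optimum near which \<open>q\<close> settles may change with the tolerance.
  Settling still makes \<open>q\<close> Cauchy along the integers; the limit then attracts
  \<open>q\<close> at all times and is dual optimal because the set of dual optima is
  closed.\<close>

lemma dual_convergence:
  assumes traj: "egpd_trajectory C V Vt gradH x q"
  shows "\<exists>qs\<in>dual_optimal C V H. (q \<longlongrightarrow> qs) at_top"
proof -
  have "Cauchy (\<lambda>n. q (real n))"
  proof (rule metric_CauchyI)
    fix e :: real assume "e > 0"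
    then have "e / 3 > 0" by simp
    obtain T y where y: "\<And>t. T \<le> t \<Longrightarrow> norm (q t - y) \<le> e / 3"
      using trajectory_settles[OF traj \<open>e / 3 > 0\<close>] by metis
    have "dist (q (real m)) (q (real n)) < e" if "nat \<lceil>T\<rceil> \<le> m" "nat \<lceil>T\<rceil> \<le> n" for m n
    proof -
      have "T \<le> real m" "T \<le> real n" using that by linarith+
      then have "norm (q (real m) - y) \<le> e / 3" "norm (q (real n) - y) \<le> e / 3" using y by auto
      then show ?thesis
        using norm_triangle_ineq4[of "q (real m) - y" "q (real n) - y"] \<open>e > 0\<close> by (simp add: dist_norm)
    qed
    then show "\<exists>M. \<forall>m\<ge>M. \<forall>n\<ge>M. dist (q (real m)) (q (real n)) < e" by blast
  qed
  then obtain l where l: "(\<lambda>n. q (real n)) \<longlonglongrightarrow> l" using Cauchy_convergent convergent_def by blast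
  have near: "\<exists>T. \<exists>y\<in>dual_optimal C V H. dist y l < e \<and> (\<forall>t\<ge>T. dist (q t) l < e)" if "e > 0" for e
  proof -
    have e: "e / 4 > 0" using that by simp
    obtain T y where y: "y \<in> dual_optimal C V H" "\<And>t. T \<le> t \<Longrightarrow> norm (q t - y) \<le> e / 4"
      using trajectory_settles[OF traj e] by metis
    obtain N where N: "\<And>n. N \<le> n \<Longrightarrow> dist (q (real n)) l < e / 4"
      using metric_LIMSEQ_D[OF l e] by blast
    define n where "n = max N (nat \<lceil>T\<rceil>)"
    have "T \<le> real n" unfolding n_def by linarith
    then have "dist (q (real n)) y \<le> e / 4" using y(2) by (simp add: dist_norm)
    then have yl: "dist y l < e / 2"
      using N[of n] dist_triangle2[of y l "q (real n)"] dist_triangle[of y l "q (real n)"] by (simp add: n_def dist_commute)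
    have "dist (q t) l < e" if "T \<le> t" for t
    proof -
      have "dist (q t) y \<le> e / 4" using y(2)[OF that] by (simp add: dist_norm)
      then show ?thesis using yl dist_triangle[of "q t" l y] e by linarith
    qed
    then show ?thesis using y(1) yl that by (intro exI[of _ T] bexI[of _ y]) auto
  qed
  have "l \<in> dual_optimal C V H"
    using near closed_approachable[OF closed_dual_optimal, of l] by blast
  moreover have "(q \<longlongrightarrow> l) at_top"
    using near by (intro tendstoI) (metis eventually_at_top_linorder)
  ultimately show ?thesis by blast
qed

end

lemma infdist_Times_le:
  assumes "A \<noteq> {}" "b \<in> B"
  shows "infdist (a, c) (A \<times> B) \<le> infdist a A + dist c b"
proof -
  have "infdist (a, c) (A \<times> B) - dist c b \<le> dist a z" if "z \<in> A" for z
  proof -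
    have "infdist (a, c) (A \<times> B) \<le> dist (a, c) (z, b)" using that assms by (intro infdist_le) auto
    also have "\<dots> \<le> dist a z + dist c b" by (simp add: dist_Pair_Pair sqrt_sum_squares_le_sum)
    finally show ?thesis by simp
  qed
  then have "infdist (a, c) (A \<times> B) - dist c b \<le> infdist a A"
    using assms(1) by (simp add: infdist_notempty cINF_greatest)
  then show ?thesis by simp
qed

lemma (in egpd_problem) uniform_convergence:
  assumes "compact VB" "VB \<subseteq> Vt" "compact QB" "\<epsilon> > 0"
  shows "\<exists>T\<ge>0. \<forall>x q. egpd_trajectory C V Vt gradH x q \<and> x 0 \<in> VB \<and> q 0 \<in> QB \<longrightarrow>
    (\<forall>t\<ge>T. within_distance \<epsilon> (x t, q t) (primal_optimal C V H \<times> dual_optimal C V H))"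
proof -
  have "\<epsilon> / 2 > 0" using assms(4) by simp
  obtain T where T: "0 \<le> T" "\<And>x q. egpd_trajectory C V Vt gradH x q \<Longrightarrow> x 0 \<in> VB \<Longrightarrow> q 0 \<in> QB \<Longrightarrow>
      \<exists>y\<in>dual_optimal C V H. \<forall>t\<ge>T. norm (q t - y) \<le> \<epsilon> / 2 \<and> infdist (x t) (primal_optimal C V H) \<le> \<epsilon> / 2"
    using uniform_settling_trajectories[OF assms(1,2) compact_imp_bounded[OF assms(3)] \<open>\<epsilon> / 2 > 0\<close>] by blast
  show ?thesis
  proof (intro exI[of _ T] conjI allI impI T(1))
    fix x q t assume "egpd_trajectory C V Vt gradH x q \<and> x 0 \<in> VB \<and> q 0 \<in> QB" "T \<le> t"
    then obtain y where y: "y \<in> dual_optimal C V H" "norm (q t - y) \<le> \<epsilon> / 2"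
      "infdist (x t) (primal_optimal C V H) \<le> \<epsilon> / 2" using T(2) by meson
    have "infdist (x t, q t) (primal_optimal C V H \<times> dual_optimal C V H) \<le> \<epsilon>"
      using infdist_Times_le[OF primal_optimal_nonempty y(1), of "x t" "q t"] y(2,3) by (simp add: dist_norm)
    then show "within_distance \<epsilon> (x t, q t) (primal_optimal C V H \<times> dual_optimal C V H)"
      using primal_optimal_nonempty y(1) by (auto simp: within_distance_def)
  qed
qed

text \<open>With \<open>K\<close> finite the region is a polytope; its compactness and convexity are
  read off from this description.\<close>

lemma rate_region_eq_convex_hull:
  assumes "finite K"
  shows "rate_region K M lam mu = convex hull (drift M lam mu ` K)"
proof
  show "rate_region K M lam mu \<subseteq> convex hull (drift M lam mu ` K)"
    unfolding rate_region_def by (force intro: convex_sum[OF assms convex_convex_hull] hull_inc)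
  show "convex hull (drift M lam mu ` K) \<subseteq> rate_region K M lam mu"
  proof (rule hull_minimal)
    show "drift M lam mu ` K \<subseteq> rate_region K M lam mu"
    proof clarify
      fix k assume k: "k \<in> K"
      have "drift M lam mu k = (\<Sum>j\<in>K. (if j = k then 1 else 0) *\<^sub>R drift M lam mu j)"
        using k assms by (simp add: if_distrib[of "\<lambda>c. c *\<^sub>R _"] cong: if_cong)
      then show "drift M lam mu k \<in> rate_region K M lam mu"
        unfolding rate_region_def using k assms
        by (intro CollectI exI[of _ "\<lambda>j. if j = k then 1 else 0"]) auto
    qed
    show "convex (rate_region K M lam mu)"
    proof (rule convexI)
      fix p q and s t :: real
      assume "p \<in> rate_region K M lam mu" "q \<in> rate_region K M lam mu" and st: "0 \<le> s" "0 \<le> t" "s + t = 1"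
      then obtain \<phi> \<psi> where \<phi>: "p = (\<Sum>k\<in>K. \<phi> k *\<^sub>R drift M lam mu k)" "\<forall>k\<in>K. 0 \<le> \<phi> k" "sum \<phi> K = 1"
        and \<psi>: "q = (\<Sum>k\<in>K. \<psi> k *\<^sub>R drift M lam mu k)" "\<forall>k\<in>K. 0 \<le> \<psi> k" "sum \<psi> K = 1"
        by (auto simp: rate_region_def)
      have "s *\<^sub>R p + t *\<^sub>R q = (\<Sum>k\<in>K. (s * \<phi> k + t * \<psi> k) *\<^sub>R drift M lam mu k)"
        by (simp add: \<phi>(1) \<psi>(1) scaleR_sum_right sum.distrib scaleR_add_left)
      moreover have "(\<Sum>k\<in>K. s * \<phi> k + t * \<psi> k) = 1"
        using st \<phi>(3) \<psi>(3) by (simp add: sum.distrib sum_distrib_left[symmetric])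
      ultimately show "s *\<^sub>R p + t *\<^sub>R q \<in> rate_region K M lam mu"
        unfolding rate_region_def using st \<phi>(2) \<psi>(2)
        by (intro CollectI exI[of _ "\<lambda>k. s * \<phi> k + t * \<psi> k"]) auto
    qed
  qed
qed

theorem theorem10:
  fixes C :: "'n::finite set"
    and K :: "'k set"
    and M :: "'w measure"
    and lam :: "'k \<Rightarrow> 'w \<Rightarrow> real ^ 'n"
    and mu :: "'k \<Rightarrow> real ^ 'n"
    and V Vt :: "(real ^ 'n) set"
    and H :: "real ^ 'n \<Rightarrow> real"
    and gradH :: "real ^ 'n \<Rightarrow> real ^ 'n"
  assumes "finite K" and "K \<noteq> {}"
    and "prob_space M"
    and "\<And>k. k \<in> K \<Longrightarrow> lam k \<in> borel_measurable M"
    and "\<And>k. k \<in> K \<Longrightarrow> \<exists>B. AE w in M. norm (lam k w) \<le> B"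
    and "\<And>k. k \<in> K \<Longrightarrow> AE w in M. \<forall>n. 0 \<le> lam k w $ n"
    and "\<And>k n. k \<in> K \<Longrightarrow> 0 \<le> mu k $ n"
    and "V = rate_region K M lam mu"
    and "V \<subseteq> Vt" and "open Vt" and "convex Vt"
    and "concave_on Vt H"
    and "\<And>z. z \<in> Vt \<Longrightarrow> GDERIV H z :> gradH z"
    and "continuous_on Vt gradH"
    and "\<And>F. F \<subseteq> - C \<Longrightarrow> \<exists>v\<in>V. (\<forall>n\<in>F. v $ n > 0) \<and> (\<forall>n\<in>-F. v $ n < 0)"
  shows "(\<forall>x q. egpd_trajectory C V Vt gradH x q \<longrightarrow>
            tends_to_set x (primal_optimal C V H)
          \<and> (\<exists>qs\<in>dual_optimal C V H. (q \<longlongrightarrow> qs) at_top))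
       \<and> (\<forall>VB QB. compact VB \<and> VB \<subseteq> Vt \<and> compact QB \<and> QB \<subseteq> dual_feasible C \<longrightarrow>
            (\<forall>\<epsilon>>0. \<exists>T\<ge>0. \<forall>x q.
               egpd_trajectory C V Vt gradH x q \<and> x 0 \<in> VB \<and> q 0 \<in> QB \<longrightarrow>
               (\<forall>t\<ge>T. within_distance \<epsilon> (x t, q t) (primal_optimal C V H \<times> dual_optimal C V H))))"
proof -
  have "egpd_problem C V Vt H gradH"
  proof
    show "compact V" "convex V"
      using assms(1,8) by (auto simp: rate_region_eq_convex_hull intro: compact_convex_hull finite_imp_compact)
  qed (use assms in auto)
  then interpret egpd_problem C V Vt H gradH .
  show ?thesis
    using primal_convergence dual_convergence uniform_convergence by blast
qed

end
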